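(* For every finite set $X$, the group $\mathfrak{BA}(X)$ of all bounded automatic automorphisms of the homogeneous rooted tree $T(X)$ is amenable.
   Context: Let $X$ be a finite set (the alphabet). The homogeneous rooted tree $T=T(X)$ has vertex set $X^*$ (all finite words over $X$, root the empty word), with an edge joining $w$ to $wx$ for all $w\in X^*$, $x\in X$. For $w\in X^*$, $T_w$ denotes the subtree of all words beginning with $w$, identified with $T$ via $w'\mapsto ww'$. Let $\mathfrak W(X)=\mathrm{Aut}(T)$ be the group of automorphisms of the rooted tree $T$. For $\alpha\in\mathfrak W(X)$ and $w\in X^*$, the state $\alpha_w\in\mathfrak W(X)$ is the automorphism obtained by restricting $\alpha$ to $T_w$ and identifying both $T_w$ and $\alpha(T_w)=T_{\alpha(w)}$ with $T$; that is, $\alpha(ww')=\alpha(w)\,\alpha_w(w')$ for all $w'\in X^*$. An automorphism $\alpha$ is automatic if its set of states $\{\alpha_w : w\in X^*\}$ is finite. It is bounded if the cardinalities of the sets $\{w\in X^n : \alpha_w\neq 1\}$ are bounded uniformly over all $n$. The automatic automorphisms form a subgroup of $\mathfrak W(X)$, as do the bounded ones, and $\mathfrak{BA}(X)$ is the (countable) group of all automorphisms that are both bounded and automatic, regarded as a discrete group. *)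

theory Defs
  imports Complex_Main "HOL-Algebra.Bij" "HOL-Algebra.Coset"
begin

section \<open>The homogeneous rooted tree and its automorphism group\<close>

text \<open>The vertices of the tree \<open>T(S)\<close> over the alphabet \<open>S\<close> are the words in \<open>lists S\<close>, the root being \<open>[]\<close>; an
  (undirected) edge is the two-element set of its end points.\<close>

definition tree_edges :: "'a set \<Rightarrow> 'a list set set" where
  "tree_edges S = {{w, w @ [x]} | w x. w \<in> lists S \<and> x \<in> S}"

text \<open>As in \<^const>\<open>Bij\<close>, automorphisms are normalised to be \<^const>\<open>undefined\<close> off the vertex set,
  so that equality of HOL functions is equality of automorphisms.\<close>

definition tree_auts :: "'a set \<Rightarrow> ('a list \<Rightarrow> 'a list) set" where
  "tree_auts S = {f \<in> Bij (lists S). f [] = [] \<and>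
     (\<forall>u\<in>lists S. \<forall>v\<in>lists S. {u, v} \<in> tree_edges S \<longleftrightarrow> {f u, f v} \<in> tree_edges S)}"

definition tree_aut_group :: "'a set \<Rightarrow> ('a list \<Rightarrow> 'a list) monoid" where
  "tree_aut_group S = BijGroup (lists S) \<lparr>carrier := tree_auts S\<rparr>"


section \<open>States\<close>

text \<open>Every tree automorphism preserves the length of words and the prefix order, so
  \<open>f (w @ u)\<close> is \<open>f w\<close> followed by the word \<^term>\<open>drop (length (f w)) (f (w @ u))\<close>; this is
  \<open>state_append\<close> below.\<close>

definition state :: "'a set \<Rightarrow> ('a list \<Rightarrow> 'a list) \<Rightarrow> 'a list \<Rightarrow> ('a list \<Rightarrow> 'a list)" where
  "state S f w = (\<lambda>u\<in>lists S. drop (length (f w)) (f (w @ u)))"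

lemma tree_auts_child:
  assumes f: "f \<in> tree_auts S" and "w \<in> lists S" "x \<in> S"
  shows "\<exists>y\<in>S. f (w @ [x]) = f w @ [y]"
  using assms(2,3)
proof (induction w arbitrary: x rule: rev_induct)
  have edge: "(\<exists>y\<in>S. f (u @ [x]) = f u @ [y]) \<or> (\<exists>y\<in>S. f u = f (u @ [x]) @ [y])"
    if "u \<in> lists S" "x \<in> S" for u x
  proof -
    have "{u, u @ [x]} \<in> tree_edges S"
      using that unfolding tree_edges_def by blast
    moreover have "u @ [x] \<in> lists S"
      using that by simp
    ultimately have "{f u, f (u @ [x])} \<in> tree_edges S"
      using f that unfolding tree_auts_def by blast
    then show ?thesis
      unfolding tree_edges_def by (auto simp: doubleton_eq_iff)
  qed
  {
    case Nil
    then show ?case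
      using edge[of "[]" x] f by (auto simp: tree_auts_def)
  next
    case (snoc a w)
    have w: "w \<in> lists S" "a \<in> S"
      using snoc.prems by auto
    then obtain b where b: "f (w @ [a]) = f w @ [b]"
      using snoc.IH by blast
    have "inj_on f (lists S)"
      using f by (auto simp: tree_auts_def Bij_def bij_betw_def)
    moreover have "(w @ [a]) @ [x] \<in> lists S"
      using snoc.prems by simp
    ultimately have "f ((w @ [a]) @ [x]) \<noteq> f w"
      using w(1) inj_onD[of f "lists S" "(w @ [a]) @ [x]" w] by auto
    then show ?case
      using edge[OF snoc.prems] b by auto
  }
qed

lemma tree_auts_append:
  assumes f: "f \<in> tree_auts S" and w: "w \<in> lists S" and u: "u \<in> lists S"
  shows "\<exists>v\<in>lists S. length v = length u \<and> f (w @ u) = f w @ v"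
  using u
proof (induction u rule: rev_induct)
  case Nil
  then show ?case by auto
next
  case (snoc x u)
  then obtain v where v: "v \<in> lists S" "length v = length u" "f (w @ u) = f w @ v"
    by auto
  have "w @ u \<in> lists S" "x \<in> S"
    using snoc.prems w by auto
  from tree_auts_child[OF f this] obtain y where "y \<in> S" "f ((w @ u) @ [x]) = f (w @ u) @ [y]"
    by blast
  then show ?case
    using v by (intro bexI[of _ "v @ [y]"]) auto
qed

lemma state_append:
  assumes "f \<in> tree_auts S" "w \<in> lists S" "u \<in> lists S"
  shows "f (w @ u) = f w @ state S f w u"
  using tree_auts_append[OF assms] assms(3) by (auto simp: state_def)

lemma tree_auts_length:
  assumes "f \<in> tree_auts S" "w \<in> lists S"
  shows "length (f w) = length w"
  using tree_auts_append[OF assms(1) _ assms(2), of "[]"] assms(1) by (auto simp: tree_auts_def)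

lemma state_in_tree_auts:
  assumes f: "f \<in> tree_auts S" and w: "w \<in> lists S"
  shows "state S f w \<in> tree_auts S"
proof -
  let ?g = "state S f w"
  have bij: "bij_betw f (lists S) (lists S)"
    using f by (auto simp: tree_auts_def Bij_def)
  have app: "f (w @ u) = f w @ ?g u" if "u \<in> lists S" for u
    using state_append[OF f w that] .
  have g_in: "?g u \<in> lists S" if "u \<in> lists S" for u
    using tree_auts_append[OF f w that] app[OF that] by auto
  have "inj_on ?g (lists S)"
  proof (rule inj_onI)
    fix u v assume uv: "u \<in> lists S" "v \<in> lists S" "?g u = ?g v"
    then have "f (w @ u) = f (w @ v)"
      using app by simp
    moreover have "w @ u \<in> lists S" "w @ v \<in> lists S"
      using w uv by auto
    ultimately have "w @ u = w @ v"
      using bij by (meson bij_betw_def inj_onD)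
    then show "u = v" by simp
  qed
  moreover have "v \<in> ?g ` lists S" if v: "v \<in> lists S" for v
  proof -
    have "f w \<in> lists S"
      using bij w by (meson bij_betwE)
    then have "f w @ v \<in> f ` lists S"
      using bij v by (auto simp: bij_betw_def)
    then obtain z where z: "z \<in> lists S" "f z = f w @ v"
      by force
    define p where "p = take (length w) z"
    define q where "q = drop (length w) z"
    have pq: "p \<in> lists S" "q \<in> lists S" "z = p @ q"
      using z(1) unfolding p_def q_def by (auto dest: in_set_takeD in_set_dropD)
    have "length z = length w + length v"
      using tree_auts_length[OF f z(1)] tree_auts_length[OF f w] z(2) by simp
    then have "length p = length w"
      by (simp add: p_def)
    then have "length (f p) = length (f w)"
      using tree_auts_length[OF f] pq w by simp
    moreover have "f p @ state S f p q = f w @ v"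
      using state_append[OF f pq(1,2)] pq(3) z(2) by simp
    ultimately have "f p = f w"
      by simp
    then have "p = w"
      using bij pq(1) w by (meson bij_betw_def inj_onD)
    then show ?thesis
      using app[OF pq(2)] pq z(2) by auto
  qed
  ultimately have "?g \<in> Bij (lists S)"
    using g_in by (auto simp: Bij_def bij_betw_def state_def)
  moreover have "?g [] = []"
    by (simp add: state_def)
  moreover have "{u, v} \<in> tree_edges S \<longleftrightarrow> {?g u, ?g v} \<in> tree_edges S"
    if u: "u \<in> lists S" and v: "v \<in> lists S" for u v
  proof -
    have cancel: "{p @ a, p @ b} \<in> tree_edges S \<longleftrightarrow> {a, b} \<in> tree_edges S"
      if "p \<in> lists S" "a \<in> lists S" "b \<in> lists S" for p a b
    proof -
      have iff: "{c, d} \<in> tree_edges S \<longleftrightarrow> (\<exists>x\<in>S. d = c @ [x]) \<or> (\<exists>x\<in>S. c = d @ [x])"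
        if "c \<in> lists S" "d \<in> lists S" for c d
        using that by (auto simp: tree_edges_def doubleton_eq_iff)
      have "p @ a \<in> lists S" "p @ b \<in> lists S"
        using that by auto
      with that show ?thesis
        by (simp add: iff)
    qed
    have "f w \<in> lists S"
      using bij w by (meson bij_betwE)
    moreover have "w @ u \<in> lists S" "w @ v \<in> lists S"
      using w u v by auto
    then have "{w @ u, w @ v} \<in> tree_edges S \<longleftrightarrow> {f (w @ u), f (w @ v)} \<in> tree_edges S"
      using f unfolding tree_auts_def by blast
    ultimately show ?thesis
      using cancel w u v g_in app by simp
  qed
  ultimately show ?thesis
    by (simp add: tree_auts_def)
qed


section \<open>Bounded automatic automorphisms\<close>

definition automatic :: "'a set \<Rightarrow> ('a list \<Rightarrow> 'a list) \<Rightarrow> bool" where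
  "automatic S f \<longleftrightarrow> finite {state S f w | w. w \<in> lists S}"

text \<open>\<^const>\<open>card\<close> is used for finite alphabets only, where all the sets below are finite.\<close>

definition bounded_aut :: "'a set \<Rightarrow> ('a list \<Rightarrow> 'a list) \<Rightarrow> bool" where
  "bounded_aut S f \<longleftrightarrow>
     (\<exists>C::nat. \<forall>n. card {w \<in> lists S. length w = n \<and> state S f w \<noteq> \<one>\<^bsub>tree_aut_group S\<^esub>} \<le> C)"

definition BA_group :: "'a set \<Rightarrow> ('a list \<Rightarrow> 'a list) monoid" where
  "BA_group S =
     tree_aut_group S \<lparr>carrier := {f \<in> tree_auts S. bounded_aut S f \<and> automatic S f}\<rparr>"


section \<open>Amenability of discrete groups\<close>

text \<open>Von Neumann's definition: there is a left invariant, finitely additive probability measure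
  defined on all subsets of the group. Only the values of \<open>\<mu>\<close> on subsets of the carrier matter.\<close>

definition amenable :: "('g, 'm) monoid_scheme \<Rightarrow> bool" where
  "amenable G \<longleftrightarrow> group G \<and>
     (\<exists>\<mu> :: 'g set \<Rightarrow> real.
        (\<forall>A \<subseteq> carrier G. 0 \<le> \<mu> A) \<and>
        \<mu> (carrier G) = 1 \<and>
        (\<forall>A \<subseteq> carrier G. \<forall>B \<subseteq> carrier G. A \<inter> B = {} \<longrightarrow> \<mu> (A \<union> B) = \<mu> A + \<mu> B) \<and>
        (\<forall>g \<in> carrier G. \<forall>A \<subseteq> carrier G. \<mu> (g <#\<^bsub>G\<^esub> A) = \<mu> A))"

end

theory Submission
  imports Defs "HOL-Analysis.Infinite_Products" "HOL-Analysis.Convex" "HOL-Analysis.Function_Topology"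
begin

text \<open>Given finitely many bounded automatic automorphisms \<open>s\<close>, there is an \<open>m\<close> such that every state
  of every \<open>s\<close> at level \<open>m\<close> is finitary of depth \<open>m\<close>, or directed: it equals its own state at one
  word \<open>v\<close> of length \<open>m\<close> and has finitary states at the other words of that length. For a fixed
  \<open>v\<close> there are finitely many directed automorphisms. Cut the words of length \<open>m K\<close> into \<open>K\<close> blocks.
  To a set \<open>E\<close> of such words attach the finite cell of all tree automorphisms whose state at a word
  \<open>u\<close> is directed along the last block of \<open>u\<close> if \<open>u \<in> E\<close>, and finitary if \<open>u \<notin> E\<close>. If \<open>E\<close> contains
  all words that are constant up to a few initial blocks, and no word with a short final constant
  run of blocks, then right multiplication by \<open>s\<close> maps the cell of \<open>E\<close> onto the cell of
  \<open>s\<^sup>-\<^sup>1(E)\<close>. So a probability distribution on sets \<open>E\<close> that is almost invariant under \<open>s\<close> yields an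
  almost right invariant mean on the full automorphism group.

  Such a distribution is obtained by putting each word \<open>u\<close> into \<open>E\<close> independently with probability
  \<open>sin\<^sup>2 t(u)\<close>, where the angle \<open>t(u)\<close> drops linearly from \<open>pi/2\<close> to \<open>0\<close> with the number of blocks of
  \<open>u\<close> before its final constant run. Only \<open>O(K)\<close> words \<open>u\<close> have \<open>t(s u) \<noteq> t(u)\<close>, with a difference
  of order \<open>1/K\<close>, so the sum of the squares of the differences tends to \<open>0\<close>. This suffices, because
  the Hellinger affinity of two such product distributions is a product of cosines of differences.\<close>

section \<open>Random subsets\<close>

text \<open>The square of \<open>bern U t E\<close> is the probability that a random subset of \<open>U\<close> equals \<open>E\<close>, if it
  contains each \<open>u\<close> independently with probability \<open>sin\<^sup>2 (t u)\<close>.\<close>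

definition bern :: "'b set \<Rightarrow> ('b \<Rightarrow> real) \<Rightarrow> 'b set \<Rightarrow> real" where
  "bern U t E = (\<Prod>u\<in>U. if u \<in> E then sin (t u) else cos (t u))"

text \<open>As a vector indexed by \<open>Pow U\<close>, \<open>bern U t\<close> is the tensor
  product over \<open>u\<close> of the plane unit vectors with coordinates \<open>cos (t u)\<close>
  and \<open>sin (t u)\<close>. Inner products of such tensors multiply, and two plane unit vectors
  contribute the cosine of the angle between them.\<close>

lemma sum_bern_mult:
  assumes "finite U"
  shows "(\<Sum>E\<in>Pow U. bern U t E * bern U t' E) = (\<Prod>u\<in>U. cos (t u - t' u))"
proof -
  have "bern U t E * bern U t' E = (\<Prod>u\<in>E. sin (t u) * sin (t' u)) * (\<Prod>u\<in>U - E. cos (t u) * cos (t' u))"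
    if "E \<in> Pow U" for E
  proof -
    have "bern U t E * bern U t' E =
        (\<Prod>u\<in>U. if u \<in> E then sin (t u) * sin (t' u) else cos (t u) * cos (t' u))"
      unfolding bern_def prod.distrib[symmetric] by (intro prod.cong) auto
    also have "\<dots> = (\<Prod>u\<in>U \<inter> E. sin (t u) * sin (t' u)) * (\<Prod>u\<in>U \<inter> - E. cos (t u) * cos (t' u))"
      using assms by (simp add: prod.If_cases)
    finally show ?thesis
      using that by (simp add: Int_absorb1 Diff_eq)
  qed
  then have "(\<Sum>E\<in>Pow U. bern U t E * bern U t' E) =
      (\<Prod>u\<in>U. sin (t u) * sin (t' u) + cos (t u) * cos (t' u))"
    by (simp add: prod_add[OF assms])
  then show ?thesis
    by (simp add: cos_diff add.commute)
qed

lemma sum_bern_square: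
  assumes "finite U"
  shows "(\<Sum>E\<in>Pow U. (bern U t E)\<^sup>2) = 1"
  using sum_bern_mult[OF assms, of t t] by (simp add: power2_eq_square)

lemma one_minus_cos_le: "1 - cos (x::real) \<le> x\<^sup>2 / 2"
proof -
  have "(sin (x / 2))\<^sup>2 \<le> (x / 2)\<^sup>2"
    using abs_sin_x_le_abs_x abs_le_square_iff by blast
  then show ?thesis
    using cos_double_sin[of "x / 2"] by (simp add: power2_eq_square)
qed

text \<open>The difference of squares factors, and Cauchy-Schwarz bounds the squared sum by
  \<open>4 (1 - \<rho>) (1 + \<rho>)\<close> with the affinity \<open>\<rho>\<close>. As
  \<open>\<rho>\<close> is a product of cosines, \<open>1 - \<rho>\<close> is at most the sum of the
  \<open>1 - cos\<close>, each of which is quadratically small.\<close>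

lemma bern_variation:
  assumes U: "finite U" and t: "\<And>u. u \<in> U \<Longrightarrow> \<bar>t u - t' u\<bar> \<le> pi / 2"
  shows "(\<Sum>E\<in>Pow U. \<bar>(bern U t E)\<^sup>2 - (bern U t' E)\<^sup>2\<bar>)\<^sup>2 \<le> 4 * (\<Sum>u\<in>U. (t u - t' u)\<^sup>2)"
proof -
  let ?q = "bern U t" and ?q' = "bern U t'"
  let ?\<rho> = "\<Sum>E\<in>Pow U. ?q E * ?q' E"
  have minus: "(\<Sum>E\<in>Pow U. \<bar>?q E - ?q' E\<bar>\<^sup>2) = 2 - 2 * ?\<rho>"
    and plus: "(\<Sum>E\<in>Pow U. \<bar>?q E + ?q' E\<bar>\<^sup>2) = 2 + 2 * ?\<rho>"
    using sum_bern_square[OF U, of t] sum_bern_square[OF U, of t']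
    by (simp_all add: power2_diff power2_sum sum.distrib sum_subtractf sum_distrib_left mult.assoc)
  have "(\<Sum>E\<in>Pow U. \<bar>(?q E)\<^sup>2 - (?q' E)\<^sup>2\<bar>)\<^sup>2 =
      (\<Sum>E\<in>Pow U. \<bar>?q E - ?q' E\<bar> * \<bar>?q E + ?q' E\<bar>)\<^sup>2"
    by (simp add: abs_mult[symmetric] power2_eq_square algebra_simps)
  also have "\<dots> \<le> (\<Sum>E\<in>Pow U. \<bar>?q E - ?q' E\<bar>\<^sup>2) * (\<Sum>E\<in>Pow U. \<bar>?q E + ?q' E\<bar>\<^sup>2)"
    by (rule Cauchy_Schwarz_ineq_sum)
  also have "\<dots> = 4 * (1 - ?\<rho>) * (1 + ?\<rho>)"
    unfolding minus plus by (simp add: algebra_simps)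
  finally have CS: "(\<Sum>E\<in>Pow U. \<bar>(?q E)\<^sup>2 - (?q' E)\<^sup>2\<bar>)\<^sup>2 \<le> 4 * (1 - ?\<rho>) * (1 + ?\<rho>)" .
  have "0 \<le> (\<Sum>E\<in>Pow U. \<bar>?q E - ?q' E\<bar>\<^sup>2)"
    by (intro sum_nonneg) simp
  then have \<rho>1: "?\<rho> \<le> 1"
    unfolding minus by simp
  \<comment> \<open>The Weierstrass inequality needs every \<open>1 - cos\<close> in the unit
    interval; differences of at most \<open>pi / 2\<close> keep the cosines nonnegative.\<close>
  have "1 - (\<Sum>u\<in>U. 1 - cos (t u - t' u)) \<le> (\<Prod>u\<in>U. 1 - (1 - cos (t u - t' u)))"
  proof (rule Weierstrass_prod_ineq)
    fix u assume "u \<in> U"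
    then have "0 \<le> cos (t u - t' u)"
      using t[of u] by (intro cos_ge_zero) linarith+
    then show "1 - cos (t u - t' u) \<in> {0..1}"
      by simp
  qed
  then have "1 - ?\<rho> \<le> (\<Sum>u\<in>U. 1 - cos (t u - t' u))"
    using sum_bern_mult[OF U, of t t'] by simp
  also have "\<dots> \<le> (\<Sum>u\<in>U. (t u - t' u)\<^sup>2 / 2)"
    by (intro sum_mono one_minus_cos_le)
  finally have \<rho>2: "1 - ?\<rho> \<le> (\<Sum>u\<in>U. (t u - t' u)\<^sup>2) / 2"
    by (simp add: sum_divide_distrib)
  have "4 * (1 - ?\<rho>) * (1 + ?\<rho>) \<le> 4 * (1 - ?\<rho>) * 2"
    using \<rho>1 by (intro mult_left_mono) simp_all
  also have "\<dots> \<le> 4 * (\<Sum>u\<in>U. (t u - t' u)\<^sup>2)"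
    using mult_left_mono[OF \<rho>2, of 8] by simp
  finally show ?thesis
    using CS by (rule order_trans[rotated])
qed

section \<open>Means\<close>

text \<open>Invariance is kept separate, because the means built below live on the full automorphism
  group but are invariant only under a subgroup.\<close>

definition mean_on :: "'g set \<Rightarrow> ('g set \<Rightarrow> real) \<Rightarrow> bool" where
  "mean_on X \<mu> \<longleftrightarrow> (\<forall>A\<subseteq>X. 0 \<le> \<mu> A) \<and> \<mu> X = 1 \<and>
     (\<forall>A\<subseteq>X. \<forall>B\<subseteq>X. A \<inter> B = {} \<longrightarrow> \<mu> (A \<union> B) = \<mu> A + \<mu> B)"

lemma mean_on_le_1:
  assumes "mean_on X \<mu>" "A \<subseteq> X"
  shows "\<mu> A \<le> 1"
proof -
  have "\<mu> (A \<union> (X - A)) = \<mu> A + \<mu> (X - A)"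
    using assms unfolding mean_on_def by blast
  moreover have "A \<union> (X - A) = X"
    using assms(2) by blast
  moreover have "0 \<le> \<mu> (X - A)"
    using assms(1) Diff_subset[of X A] unfolding mean_on_def by simp
  moreover have "\<mu> X = 1"
    using assms(1) by (simp add: mean_on_def)
  ultimately show ?thesis
    by (metis add_increasing2 order_refl)
qed

section \<open>From almost invariant to invariant means\<close>

lemma compact_unit_cube: "compact (PiE UNIV (\<lambda>_::'i. {0..1::real}))"
proof -
  have "compactin (product_topology (\<lambda>_::'i. euclidean::real topology) UNIV) (PiE UNIV (\<lambda>_. {0..1}))"
    unfolding compactin_PiE by simp
  then show ?thesis
    unfolding euclidean_product_topology by simp
qed

text \<open>Each single condition involves only finitely many values of \<open>\<mu>\<close>, so it
  is closed in the product topology.\<close>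

lemma closed_mean_on: "closed {\<mu>. mean_on X \<mu>}"
proof -
  have "{\<mu>::'a set \<Rightarrow> real. mean_on X \<mu>} = (\<Inter>A\<in>Pow X. {\<mu>. 0 \<le> \<mu> A}) \<inter> {\<mu>. \<mu> X = 1} \<inter>
      (\<Inter>(A, B)\<in>{(A, B). A \<subseteq> X \<and> B \<subseteq> X \<and> A \<inter> B = {}}. {\<mu>. \<mu> (A \<union> B) = \<mu> A + \<mu> B})"
    unfolding mean_on_def by auto
  also have "closed \<dots>"
    by (intro closed_Int closed_INT ballI)
      (auto intro!: closed_Collect_le closed_Collect_eq continuous_intros)
  finally show ?thesis .
qed

text \<open>Means form a compact set by Tychonoff. Those that \<open>s\<close> moves by at most
  \<open>1 / (n + 1)\<close> form a closed subset, and any finitely many of these subsets meet by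
  \<open>approx\<close>. A mean common to all of them is invariant.\<close>

lemma invariant_mean_from_almost_invariant:
  fixes T :: "'s \<Rightarrow> 'g set \<Rightarrow> 'g set"
  assumes T: "\<And>s A. s \<in> C \<Longrightarrow> A \<subseteq> X \<Longrightarrow> T s A \<subseteq> X"
    and approx: "\<And>F e. finite F \<Longrightarrow> F \<subseteq> C \<Longrightarrow> 0 < (e::real) \<Longrightarrow>
      \<exists>\<mu>. mean_on X \<mu> \<and> (\<forall>s\<in>F. \<forall>A\<subseteq>X. \<bar>\<mu> (T s A) - \<mu> A\<bar> \<le> e)"
  shows "\<exists>\<mu>. mean_on X \<mu> \<and> (\<forall>s\<in>C. \<forall>A\<subseteq>X. \<mu> (T s A) = \<mu> A)"
proof -
  let ?K = "PiE UNIV (\<lambda>_::'g set. {0..1::real}) \<inter> {\<mu>. mean_on X \<mu>}"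
  define Z :: "'s \<times> nat \<Rightarrow> ('g set \<Rightarrow> real) set" where
    "Z p = (\<Inter>A\<in>Pow X. {\<mu>. \<bar>\<mu> (T (fst p) A) - \<mu> A\<bar> \<le> 1 / (real (snd p) + 1)})" for p
  have "compact ?K"
    by (rule compact_Int_closed[OF compact_unit_cube closed_mean_on])
  moreover have "closed (Z p)" for p
    unfolding Z_def by (intro closed_INT ballI closed_Collect_le continuous_intros) simp_all
  moreover have "?K \<inter> (\<Inter>p\<in>I. Z p) \<noteq> {}" if I: "finite I" "I \<subseteq> C \<times> UNIV" for I
  proof -
    \<comment> \<open>The inserted 1 keeps the minimum meaningful when \<open>I\<close> is
      empty.\<close>
    define e where "e = Min (insert 1 ((\<lambda>p. 1 / (real (snd p) + 1)) ` I))"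
    have e: "0 < e" "\<And>p. p \<in> I \<Longrightarrow> e \<le> 1 / (real (snd p) + 1)"
      using I(1) by (auto simp: e_def)
    have "finite (fst ` I)" "fst ` I \<subseteq> C"
      using I by auto
    from approx[OF this e(1)] obtain \<mu> where \<mu>: "mean_on X \<mu>"
      "\<And>s A. s \<in> fst ` I \<Longrightarrow> A \<subseteq> X \<Longrightarrow> \<bar>\<mu> (T s A) - \<mu> A\<bar> \<le> e"
      by blast
    \<comment> \<open>\<open>\<mu>\<close> is arbitrary on sets that are not contained in
      \<open>X\<close>; cutting down to \<open>X\<close> puts all values into the unit interval
      without affecting subsets of \<open>X\<close>.\<close>
    define \<nu> where "\<nu> A = \<mu> (A \<inter> X)" for A
    have \<nu>: "\<nu> A = \<mu> A" if "A \<subseteq> X" for A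
      using that by (simp add: \<nu>_def Int_absorb2)
    have "mean_on X \<nu>"
      using \<mu>(1) \<nu> unfolding mean_on_def by (metis Un_least order_refl)
    moreover have "\<nu> \<in> PiE UNIV (\<lambda>_. {0..1})"
      using mean_on_le_1[OF \<mu>(1)] \<mu>(1) by (auto simp: \<nu>_def mean_on_def)
    moreover have "\<nu> \<in> Z p" if p: "p \<in> I" for p
    proof -
      have "fst p \<in> C"
        using p I(2) by auto
      then have "\<bar>\<nu> (T (fst p) A) - \<nu> A\<bar> \<le> 1 / (real (snd p) + 1)" if "A \<subseteq> X" for A
        using \<mu>(2)[of "fst p" A] e(2)[OF p] p that \<nu>[OF that] \<nu>[OF T[OF _ that]] by force
      then show ?thesis
        by (simp add: Z_def)
    qed
    ultimately show ?thesis
      by blast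
  qed
  ultimately have "?K \<inter> (\<Inter>p\<in>C \<times> UNIV. Z p) \<noteq> {}"
    by (rule compact_imp_fip_image)
  then obtain \<mu> where \<mu>: "mean_on X \<mu>" "\<And>s n. s \<in> C \<Longrightarrow> \<mu> \<in> Z (s, n)"
    by blast
  have "\<mu> (T s A) = \<mu> A" if "s \<in> C" "A \<subseteq> X" for s A
  proof -
    have le: "\<bar>\<mu> (T s A) - \<mu> A\<bar> \<le> 1 / (real n + 1)" for n
      using \<mu>(2)[OF that(1), of n] that(2) by (simp add: Z_def)
    have "\<bar>\<mu> (T s A) - \<mu> A\<bar> \<le> 0"
    proof (rule field_le_epsilon)
      fix e :: real assume "0 < e"
      then obtain n where "1 / (real n + 1) < e"
        using nat_approx_posE[of e] by (metis of_nat_Suc add.commute)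
      then show "\<bar>\<mu> (T s A) - \<mu> A\<bar> \<le> 0 + e"
        using le[of n] by linarith
    qed
    then show ?thesis
      by simp
  qed
  then show ?thesis
    using \<mu>(1) by blast
qed

text \<open>\<open>C\<close> acts freely on \<open>W\<close> by right translations, with the left
  cosets as orbits. A choice of one point per orbit gives an equivariant map from \<open>W\<close>
  to \<open>C\<close>, along which \<open>m\<close> is pushed forward.\<close>

lemma amenable_subgroup_from_right_invariant_mean:
  assumes W: "group W" and C: "subgroup C W"
    and m: "mean_on (carrier W) m"
    and inv: "\<And>s A. s \<in> C \<Longrightarrow> A \<subseteq> carrier W \<Longrightarrow> m ((\<lambda>a. a \<otimes>\<^bsub>W\<^esub> s) ` A) = m A"
  shows "amenable (W\<lparr>carrier := C\<rparr>)"
proof -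
  interpret W: group W
    by (rule W)
  interpret C: subgroup C W
    by (rule C)
  define rep where "rep Y = (SOME x. x \<in> Y)" for Y :: "'a set"
  \<comment> \<open>\<open>\<rho>\<close> intertwines right translations of \<open>W\<close> by \<open>C\<close> with left translations of \<open>C\<close>, so it carries the right
    invariant mean \<open>m\<close> to a left invariant one.\<close>
  define \<rho> where "\<rho> w = inv\<^bsub>W\<^esub> w \<otimes>\<^bsub>W\<^esub> rep (w <#\<^bsub>W\<^esub> C)" for w
  have rep: "\<exists>c\<in>C. rep (w <#\<^bsub>W\<^esub> C) = w \<otimes>\<^bsub>W\<^esub> c" for w
  proof -
    have "w \<otimes>\<^bsub>W\<^esub> \<one>\<^bsub>W\<^esub> \<in> w <#\<^bsub>W\<^esub> C"
      unfolding l_coset_def using C.one_closed by blast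
    then have "rep (w <#\<^bsub>W\<^esub> C) \<in> w <#\<^bsub>W\<^esub> C"
      unfolding rep_def by (rule someI)
    then show ?thesis
      unfolding l_coset_def by blast
  qed
  have \<rho>C: "\<rho> w \<in> C" if w: "w \<in> carrier W" for w
  proof -
    obtain c where c: "c \<in> C" "rep (w <#\<^bsub>W\<^esub> C) = w \<otimes>\<^bsub>W\<^esub> c"
      using rep by blast
    then have "\<rho> w = c"
      unfolding \<rho>_def c(2) using w C.mem_carrier[OF c(1)] by (simp add: W.m_assoc[symmetric])
    then show ?thesis
      using c(1) by simp
  qed
  have \<rho>_mult: "\<rho> (w \<otimes>\<^bsub>W\<^esub> s) = inv\<^bsub>W\<^esub> s \<otimes>\<^bsub>W\<^esub> \<rho> w" if w: "w \<in> carrier W" and s: "s \<in> C" for w s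
  proof -
    have sW: "s \<in> carrier W"
      using s by (rule C.mem_carrier)
    \<comment> \<open>A right factor from \<open>C\<close> does not change the left coset, so the
      same representative is chosen before and after the translation.\<close>
    have "(w \<otimes>\<^bsub>W\<^esub> s) <#\<^bsub>W\<^esub> C = w <#\<^bsub>W\<^esub> (s <#\<^bsub>W\<^esub> C)"
      by (rule W.lcos_m_assoc[symmetric, OF C.subset w sW])
    also have "s <#\<^bsub>W\<^esub> C = C"
      by (rule W.coset_join3[OF sW C s])
    finally have eq: "(w \<otimes>\<^bsub>W\<^esub> s) <#\<^bsub>W\<^esub> C = w <#\<^bsub>W\<^esub> C" .
    obtain c where "c \<in> C" "rep (w <#\<^bsub>W\<^esub> C) = w \<otimes>\<^bsub>W\<^esub> c"
      using rep by blast
    then have "rep (w <#\<^bsub>W\<^esub> C) \<in> carrier W"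
      using w C.mem_carrier by simp
    then show ?thesis
      unfolding \<rho>_def eq using w sW by (simp add: W.inv_mult_group W.m_assoc)
  qed
  define P where "P A = {w \<in> carrier W. \<rho> w \<in> A}" for A
  define \<mu> where "\<mu> A = m (P A)" for A
  have PW: "P A \<subseteq> carrier W" for A
    by (auto simp: P_def)
  have "\<mu> (g <#\<^bsub>W\<^esub> A) = \<mu> A" if g: "g \<in> C" and A: "A \<subseteq> C" for g A
  proof -
    have gW: "g \<in> carrier W"
      using g by (rule C.mem_carrier)
    have gi: "inv\<^bsub>W\<^esub> g \<in> C"
      using g by (rule C.m_inv_closed)
    \<comment> \<open>By \<open>\<rho>_mult\<close> for the inverse of \<open>g\<close>, translating
      \<open>w\<close> on the right by that inverse multiplies \<open>\<rho> w\<close> by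
      \<open>g\<close> on the left.\<close>
    have "P (g <#\<^bsub>W\<^esub> A) = (\<lambda>a. a \<otimes>\<^bsub>W\<^esub> inv\<^bsub>W\<^esub> g) ` P A"
    proof (intro equalityI subsetI)
      fix w assume "w \<in> P (g <#\<^bsub>W\<^esub> A)"
      then obtain a where w: "w \<in> carrier W" and a: "a \<in> A" "\<rho> w = g \<otimes>\<^bsub>W\<^esub> a"
        by (auto simp: P_def l_coset_def)
      have aW: "a \<in> carrier W"
        using a A C.mem_carrier by blast
      have "\<rho> (w \<otimes>\<^bsub>W\<^esub> g) = a"
        using \<rho>_mult[OF w g] a(2) aW gW by (simp add: W.m_assoc[symmetric])
      then have "w \<otimes>\<^bsub>W\<^esub> g \<in> P A"
        using w gW a(1) by (simp add: P_def)
      moreover have "w = (w \<otimes>\<^bsub>W\<^esub> g) \<otimes>\<^bsub>W\<^esub> inv\<^bsub>W\<^esub> g"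
        using w gW by (simp add: W.m_assoc)
      ultimately show "w \<in> (\<lambda>a. a \<otimes>\<^bsub>W\<^esub> inv\<^bsub>W\<^esub> g) ` P A"
        by blast
    next
      fix w assume "w \<in> (\<lambda>a. a \<otimes>\<^bsub>W\<^esub> inv\<^bsub>W\<^esub> g) ` P A"
      then obtain v where v: "v \<in> carrier W" "\<rho> v \<in> A" "w = v \<otimes>\<^bsub>W\<^esub> inv\<^bsub>W\<^esub> g"
        by (auto simp: P_def)
      have "\<rho> w = g \<otimes>\<^bsub>W\<^esub> \<rho> v"
        using \<rho>_mult[OF v(1) gi] v(3) gW by simp
      then show "w \<in> P (g <#\<^bsub>W\<^esub> A)"
        using v gW by (auto simp: P_def l_coset_def)
    qed
    then show ?thesis
      using inv[OF gi PW] by (simp add: \<mu>_def)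
  qed
  moreover have "P C = carrier W"
    using \<rho>C by (auto simp: P_def)
  moreover have "\<mu> (A \<union> B) = \<mu> A + \<mu> B" if "A \<inter> B = {}" for A B
  proof -
    have "P (A \<union> B) = P A \<union> P B" "P A \<inter> P B = {}"
      using that by (auto simp: P_def)
    then show ?thesis
      using m PW by (simp add: \<mu>_def mean_on_def)
  qed
  moreover have "0 \<le> \<mu> A" for A
    using m PW by (simp add: \<mu>_def mean_on_def)
  moreover have "m (carrier W) = 1"
    using m by (simp add: mean_on_def)
  ultimately have "(\<forall>A\<subseteq>C. 0 \<le> \<mu> A) \<and> \<mu> C = 1 \<and>
      (\<forall>A\<subseteq>C. \<forall>B\<subseteq>C. A \<inter> B = {} \<longrightarrow> \<mu> (A \<union> B) = \<mu> A + \<mu> B) \<and>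
      (\<forall>g\<in>C. \<forall>A\<subseteq>C. \<mu> (g <#\<^bsub>W\<^esub> A) = \<mu> A)"
    by (simp add: \<mu>_def)
  moreover have "g <#\<^bsub>W\<lparr>carrier := C\<rparr>\<^esub> A = g <#\<^bsub>W\<^esub> A" for g A
    by (simp add: l_coset_def)
  ultimately show ?thesis
    unfolding amenable_def using C.subgroup_is_group[OF W] by auto
qed

section \<open>The group of tree automorphisms\<close>

lemma subgroup_tree_auts: "subgroup (tree_auts S) (BijGroup (lists S))"
proof -
  interpret group "BijGroup (lists S)"
    by (rule group_BijGroup)
  show ?thesis
  proof (rule subgroupI)
    show "tree_auts S \<subseteq> carrier (BijGroup (lists S))"
      by (auto simp: tree_auts_def BijGroup_def)
    have "(\<lambda>x\<in>lists S. x) \<in> tree_auts S"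
      by (auto simp: tree_auts_def id_Bij)
    then show "tree_auts S \<noteq> {}"
      by blast
  next
    fix f assume f: "f \<in> tree_auts S"
    then have fB: "f \<in> Bij (lists S)"
      by (simp add: tree_auts_def)
    then have bij: "bij_betw f (lists S) (lists S)"
      by (simp add: Bij_def)
    let ?h = "\<lambda>x\<in>lists S. inv_into (lists S) f x"
    have h: "?h u \<in> lists S" "f (?h u) = u" if "u \<in> lists S" for u
      using that bij_betw_inv_into_right[OF bij] bij_betwE[OF bij_betw_inv_into[OF bij]] by auto
    have "?h \<in> Bij (lists S)"
      using fB by (rule restrict_inv_into_Bij)
    moreover have "?h [] = []"
      using bij_betw_inv_into_left[OF bij, of "[]"] f by (simp add: tree_auts_def)
    moreover have "{u, v} \<in> tree_edges S \<longleftrightarrow> {?h u, ?h v} \<in> tree_edges S"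
      if "u \<in> lists S" "v \<in> lists S" for u v
    proof -
      have "{?h u, ?h v} \<in> tree_edges S \<longleftrightarrow> {f (?h u), f (?h v)} \<in> tree_edges S"
        using f h(1) that unfolding tree_auts_def by blast
      then show ?thesis
        unfolding h(2)[OF that(1)] h(2)[OF that(2)] by simp
    qed
    ultimately show "inv\<^bsub>BijGroup (lists S)\<^esub> f \<in> tree_auts S"
      unfolding inv_BijGroup[OF fB] by (simp add: tree_auts_def)
  next
    fix f g assume f: "f \<in> tree_auts S" and g: "g \<in> tree_auts S"
    have B: "f \<in> Bij (lists S)" "g \<in> Bij (lists S)"
      using f g by (auto simp: tree_auts_def)
    have gl: "g u \<in> lists S" if "u \<in> lists S" for u
      using B(2) that by (auto simp: Bij_def dest: bij_betwE)
    have "{u, v} \<in> tree_edges S \<longleftrightarrow> {f (g u), f (g v)} \<in> tree_edges S"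
      if "u \<in> lists S" "v \<in> lists S" for u v
    proof -
      have "{u, v} \<in> tree_edges S \<longleftrightarrow> {g u, g v} \<in> tree_edges S"
        using g that unfolding tree_auts_def by blast
      also have "\<dots> \<longleftrightarrow> {f (g u), f (g v)} \<in> tree_edges S"
        using f gl that unfolding tree_auts_def by blast
      finally show ?thesis .
    qed
    then show "f \<otimes>\<^bsub>BijGroup (lists S)\<^esub> g \<in> tree_auts S"
      using f g B compose_Bij[OF B] unfolding tree_auts_def
      by (simp add: BijGroup_def compose_eq)
  qed
qed

lemma group_tree_aut_group: "group (tree_aut_group S)"
  unfolding tree_aut_group_def
  by (rule subgroup.subgroup_is_group[OF subgroup_tree_auts group_BijGroup])

definition words :: "'a set \<Rightarrow> nat \<Rightarrow> 'a list set" where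
  "words S n = {w \<in> lists S. length w = n}"

lemma words_lists: "w \<in> words S n \<Longrightarrow> w \<in> lists S"
  by (simp add: words_def)

lemma append_words: "w \<in> words S m \<Longrightarrow> u \<in> words S n \<Longrightarrow> w @ u \<in> words S (m + n)"
  by (simp add: words_def)

lemma words_split:
  assumes "w \<in> words S (m + n)"
  obtains u v where "u \<in> words S m" "v \<in> words S n" "w = u @ v"
proof
  show "take m w \<in> words S m" "drop m w \<in> words S n"
    using assms set_take_subset[of m w] set_drop_subset[of m w] by (auto simp: words_def lists_eq_set)
qed simp

locale finite_alphabet =
  fixes S :: "'a set"
  assumes finite_S: "finite S"
begin

abbreviation W :: "('a list \<Rightarrow> 'a list) monoid" where
  "W \<equiv> tree_aut_group S"

abbreviation aut_mult (infixl "\<cdot>" 70) where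
  "f \<cdot> g \<equiv> f \<otimes>\<^bsub>W\<^esub> g"

abbreviation aut_inv where
  "aut_inv f \<equiv> inv\<^bsub>W\<^esub> f"

abbreviation aut_one where
  "aut_one \<equiv> \<one>\<^bsub>W\<^esub>"

abbreviation st where
  "st \<equiv> state S"

abbreviation Aut where
  "Aut \<equiv> tree_auts S"

sublocale W: group W
  by (rule group_tree_aut_group)

lemma finite_words: "finite (words S n)"
  using finite_lists_length_eq[OF finite_S, of n] by (simp add: words_def lists_eq_set)

lemma carrier_W [simp]: "carrier W = Aut"
  by (simp add: tree_aut_group_def)

lemma aut_closed [simp, intro]:
  "f \<in> Aut \<Longrightarrow> g \<in> Aut \<Longrightarrow> f \<cdot> g \<in> Aut" "aut_one \<in> Aut" "f \<in> Aut \<Longrightarrow> aut_inv f \<in> Aut"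
  using W.m_closed[of f g] W.one_closed W.inv_closed[of f] by simp_all

lemma aut_Bij: "f \<in> Aut \<Longrightarrow> f \<in> Bij (lists S)"
  unfolding tree_auts_def by blast

lemma aut_lists [simp]: "f \<in> Aut \<Longrightarrow> u \<in> lists S \<Longrightarrow> f u \<in> lists S"
  using Bij_imp_funcset[OF aut_Bij] by blast

lemma aut_words [simp]: "f \<in> Aut \<Longrightarrow> u \<in> words S n \<Longrightarrow> f u \<in> words S n"
  unfolding words_def using tree_auts_length[of f S u] aut_lists[of f u] by simp

lemma aut_inj: "f \<in> Aut \<Longrightarrow> inj_on f (lists S)"
  using aut_Bij[of f] by (simp add: Bij_def bij_betw_def)

lemma aut_Nil [simp]: "f \<in> Aut \<Longrightarrow> f [] = []"
  unfolding tree_auts_def by blast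

lemma aut_mult_apply [simp]:
  assumes "f \<in> Aut" "g \<in> Aut" "u \<in> lists S"
  shows "(f \<cdot> g) u = f (g u)"
  using aut_Bij[OF assms(1)] aut_Bij[OF assms(2)] assms(3)
  by (simp add: tree_aut_group_def BijGroup_def compose_eq)

lemma aut_one_apply [simp]: "u \<in> lists S \<Longrightarrow> aut_one u = u"
  by (simp add: tree_aut_group_def BijGroup_def)

lemma aut_ext:
  assumes "f \<in> Aut" "g \<in> Aut" "\<And>u. u \<in> lists S \<Longrightarrow> f u = g u"
  shows "f = g"
  using Bij_imp_extensional[OF aut_Bij[OF assms(1)]] Bij_imp_extensional[OF aut_Bij[OF assms(2)]]
    assms(3) by (rule extensionalityI)

lemma aut_inv_apply:
  assumes f: "f \<in> Aut" and u: "u \<in> lists S"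
  shows "f (aut_inv f u) = u" "aut_inv f (f u) = u"
proof -
  have "f \<cdot> aut_inv f = aut_one" "aut_inv f \<cdot> f = aut_one"
    using f by simp_all
  then show "f (aut_inv f u) = u" "aut_inv f (f u) = u"
    using aut_mult_apply[OF f aut_closed(3)[OF f] u] aut_mult_apply[OF aut_closed(3)[OF f] f u]
      aut_one_apply[OF u] by auto
qed

lemma st_Aut [simp, intro]: "f \<in> Aut \<Longrightarrow> w \<in> lists S \<Longrightarrow> st f w \<in> Aut"
  by (rule state_in_tree_auts)

text \<open>Words cancel on the left, so the decomposition of \<open>f (w @ u)\<close> determines
  the state. The rules for states of the identity, of states and of products all follow from
  this.\<close>

lemma st_unique:
  assumes "f \<in> Aut" "w \<in> lists S" "g \<in> Aut" "\<And>u. u \<in> lists S \<Longrightarrow> f (w @ u) = f w @ g u"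
  shows "st f w = g"
proof (rule aut_ext)
  fix u assume "u \<in> lists S"
  then show "st f w u = g u"
    using state_append[OF assms(1,2)] assms(4) by fastforce
qed (use assms in auto)

lemma st_Nil [simp]: "f \<in> Aut \<Longrightarrow> st f [] = f"
  by (rule st_unique) auto

lemma st_one [simp]: "w \<in> lists S \<Longrightarrow> st aut_one w = aut_one"
  by (rule st_unique) auto

lemma st_append:
  assumes "f \<in> Aut" "w \<in> lists S" "u \<in> lists S"
  shows "st f (w @ u) = st (st f w) u"
proof (rule st_unique)
  fix v assume "v \<in> lists S"
  then show "f ((w @ u) @ v) = f (w @ u) @ st (st f w) u v"
    using assms state_append[of f S w "u @ v"] state_append[of "st f w" S u v] state_append[of f S w u]
    by simp
qed (use assms in auto)

text \<open>A chain rule: \<open>g\<close> acts first and moves \<open>w\<close> to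
  \<open>g w\<close>, which is where the state of \<open>f\<close> has to be taken.\<close>

lemma st_mult:
  assumes "f \<in> Aut" "g \<in> Aut" "w \<in> lists S"
  shows "st (f \<cdot> g) w = st f (g w) \<cdot> st g w"
proof (rule st_unique)
  fix u assume "u \<in> lists S"
  then show "(f \<cdot> g) (w @ u) = (f \<cdot> g) w @ (st f (g w) \<cdot> st g w) u"
    using assms state_append[of g S w u] state_append[of f S "g w" "st g w u"] by simp
qed (use assms in auto)

lemma st_inv:
  assumes f: "f \<in> Aut" and w: "w \<in> lists S"
  shows "st (aut_inv f) w = aut_inv (st f (aut_inv f w))"
proof -
  have i: "aut_inv f \<in> Aut" and l: "aut_inv f w \<in> lists S"
    using f w by simp_all
  have r: "f \<cdot> aut_inv f = aut_one"
    using f by simp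
  have "st f (aut_inv f w) \<cdot> st (aut_inv f) w = aut_one"
    using st_mult[OF f i w] unfolding r using w by simp
  then have "aut_inv (st (aut_inv f) w) = st f (aut_inv f w)"
    using f l i w by (intro W.inv_equality) simp_all
  then show ?thesis
    using W.inv_inv[of "st (aut_inv f) w"] i w by simp
qed

section \<open>The subgroup of bounded automatic automorphisms\<close>

definition active :: "('a list \<Rightarrow> 'a list) \<Rightarrow> nat \<Rightarrow> 'a list set" where
  "active f n = {w \<in> lists S. length w = n \<and> st f w \<noteq> aut_one}"

lemma finite_active: "finite (active f n)"
  by (rule finite_subset[OF _ finite_words[of n]]) (auto simp: active_def words_def)

lemma bounded_aut_active: "bounded_aut S f \<longleftrightarrow> (\<exists>C. \<forall>n. card (active f n) \<le> C)"
  by (simp add: bounded_aut_def active_def)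

text \<open>The state of the inverse at \<open>w\<close> is the inverse of the state of
  \<open>f\<close> at the preimage of \<open>w\<close>, so the inverse has no more active words per
  level than \<open>f\<close>.\<close>

lemma active_inv: "f \<in> Aut \<Longrightarrow> active (aut_inv f) n \<subseteq> f ` active f n"
proof
  fix w assume f: "f \<in> Aut" and w: "w \<in> active (aut_inv f) n"
  then have wl: "w \<in> lists S" "length w = n" "st (aut_inv f) w \<noteq> aut_one"
    by (simp_all add: active_def)
  have "st f (aut_inv f w) \<noteq> aut_one"
    using wl(3) unfolding st_inv[OF f wl(1)] by (metis W.inv_one)
  moreover have "length (aut_inv f w) = n"
    using tree_auts_length[of "aut_inv f" S w] f wl by simp
  ultimately have "aut_inv f w \<in> active f n"
    using f wl by (simp add: active_def)
  moreover have "w = f (aut_inv f w)"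
    using aut_inv_apply(1)[OF f wl(1)] by simp
  ultimately show "w \<in> f ` active f n"
    by blast
qed

text \<open>By the chain rule a word is active for the product only if it is active for
  \<open>g\<close>, or if \<open>g\<close> moves it to a word that is active for
  \<open>f\<close>.\<close>

lemma active_mult:
  assumes f: "f \<in> Aut" and g: "g \<in> Aut"
  shows "active (f \<cdot> g) n \<subseteq> aut_inv g ` active f n \<union> active g n"
proof
  fix w assume w: "w \<in> active (f \<cdot> g) n"
  then have wl: "w \<in> lists S" "length w = n" "st (f \<cdot> g) w \<noteq> aut_one"
    by (simp_all add: active_def)
  show "w \<in> aut_inv g ` active f n \<union> active g n"
  proof (cases "st g w = aut_one")
    case True
    then have "st f (g w) \<noteq> aut_one"
      using wl(3) f g wl(1) unfolding st_mult[OF f g wl(1)] by force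
    then have "g w \<in> active f n"
      using g wl tree_auts_length[OF g wl(1)] by (simp add: active_def)
    then show ?thesis
      using aut_inv_apply(2)[OF g wl(1)] by (metis UnI1 image_eqI)
  next
    case False
    then show ?thesis
      using wl by (simp add: active_def)
  qed
qed

lemma subgroup_bounded_automatic:
  "subgroup {f \<in> Aut. bounded_aut S f \<and> automatic S f} W"
proof (rule W.subgroupI)
  show "{f \<in> Aut. bounded_aut S f \<and> automatic S f} \<subseteq> carrier W"
    by (simp add: subset_iff)
next
  have "active aut_one n = {}" for n
    using st_one by (auto simp: active_def)
  then have "bounded_aut S aut_one"
    by (simp add: bounded_aut_active)
  moreover have "{st aut_one w | w. w \<in> lists S} \<subseteq> {aut_one}"
    using st_one by blast
  then have "automatic S aut_one"
    unfolding automatic_def by (rule finite_subset) simp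
  ultimately show "{f \<in> Aut. bounded_aut S f \<and> automatic S f} \<noteq> {}"
    using aut_closed(2) by blast
next
  fix f assume "f \<in> {f \<in> Aut. bounded_aut S f \<and> automatic S f}"
  then have f: "f \<in> Aut" "bounded_aut S f" "automatic S f"
    by simp_all
  obtain C where C: "\<And>n. card (active f n) \<le> C"
    using f(2) unfolding bounded_aut_active by blast
  have "card (active (aut_inv f) n) \<le> C" for n
    using surj_card_le[OF finite_active active_inv[OF f(1)]] C le_trans by blast
  then have "bounded_aut S (aut_inv f)"
    unfolding bounded_aut_active by blast
  moreover have "{st (aut_inv f) w | w. w \<in> lists S} \<subseteq> aut_inv ` {st f w | w. w \<in> lists S}"
    using st_inv[OF f(1)] aut_lists[OF aut_closed(3)[OF f(1)]] by blast
  then have "automatic S (aut_inv f)"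
    using f(3) finite_surj unfolding automatic_def by blast
  ultimately show "aut_inv f \<in> {f \<in> Aut. bounded_aut S f \<and> automatic S f}"
    using f(1) by simp
next
  fix f g assume "f \<in> {f \<in> Aut. bounded_aut S f \<and> automatic S f}"
    and "g \<in> {f \<in> Aut. bounded_aut S f \<and> automatic S f}"
  then have f: "f \<in> Aut" "bounded_aut S f" "automatic S f"
    and g: "g \<in> Aut" "bounded_aut S g" "automatic S g"
    by simp_all
  obtain C D where C: "\<And>n. card (active f n) \<le> C" and D: "\<And>n. card (active g n) \<le> D"
    using f(2) g(2) unfolding bounded_aut_active by blast
  have "card (active (f \<cdot> g) n) \<le> C + D" for n
  proof -
    have "card (active (f \<cdot> g) n) \<le> card (aut_inv g ` active f n \<union> active g n)"
      using active_mult[OF f(1) g(1)] finite_active by (intro card_mono) auto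
    also have "\<dots> \<le> card (aut_inv g ` active f n) + card (active g n)"
      by (rule card_Un_le)
    also have "card (aut_inv g ` active f n) \<le> card (active f n)"
      by (rule card_image_le[OF finite_active])
    finally show ?thesis
      using C[of n] D[of n] by linarith
  qed
  then have "bounded_aut S (f \<cdot> g)"
    unfolding bounded_aut_active by blast
  moreover have "{st (f \<cdot> g) w | w. w \<in> lists S} \<subseteq>
     (\<lambda>(a, b). a \<cdot> b) ` ({st f w | w. w \<in> lists S} \<times> {st g w | w. w \<in> lists S})"
    using st_mult[OF f(1) g(1)] aut_lists[OF g(1)] by fastforce
  then have "automatic S (f \<cdot> g)"
    unfolding automatic_def
    by (rule finite_surj[OF finite_cartesian_product[OF f(3)[unfolded automatic_def] g(3)[unfolded automatic_def]]])
  ultimately show "f \<cdot> g \<in> {f \<in> Aut. bounded_aut S f \<and> automatic S f}"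
    using f(1) g(1) by simp
qed

text \<open>An automorphism is determined by its values on words of length at most \<open>d\<close>
  together with its states at level \<open>d\<close>, and there are finitely many possibilities for
  both.\<close>

lemma finite_auts_with_states_in:
  assumes R: "finite R"
  shows "finite {f \<in> Aut. \<forall>w\<in>words S d. st f w \<in> R}"
proof -
  let ?L = "{w \<in> lists S. length w \<le> d}"
  have finL: "finite ?L"
    using finite_lists_length_le[OF finite_S, of d] by (simp add: lists_eq_set)
  let ?F = "{f \<in> Aut. \<forall>w\<in>words S d. st f w \<in> R}"
  let ?\<Phi> = "\<lambda>f. (restrict f ?L, restrict (st f) (words S d))"
  have "?\<Phi> ` ?F \<subseteq> PiE ?L (\<lambda>_. ?L) \<times> PiE (words S d) (\<lambda>_. R)"
  proof (clarify, intro conjI)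
    fix f assume f: "f \<in> Aut" "\<forall>w\<in>words S d. st f w \<in> R"
    show "restrict f ?L \<in> PiE ?L (\<lambda>_. ?L)"
      using f(1) aut_lists[OF f(1)] tree_auts_length[OF f(1)] by simp
    show "restrict (st f) (words S d) \<in> PiE (words S d) (\<lambda>_. R)"
      using f(2) by simp
  qed
  moreover have "finite (PiE ?L (\<lambda>_. ?L) \<times> PiE (words S d) (\<lambda>_. R))"
    using finL R finite_words by (intro finite_cartesian_product finite_PiE) auto
  ultimately have "finite (?\<Phi> ` ?F)"
    by (rule finite_subset)
  moreover have "inj_on ?\<Phi> ?F"
  proof (rule inj_onI)
    fix f g assume f: "f \<in> ?F" and g: "g \<in> ?F" and eq: "?\<Phi> f = ?\<Phi> g"
    have short: "f u = g u" if "u \<in> lists S" "length u \<le> d" for u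
      using eq that by (metis (no_types, lifting) mem_Collect_eq prod.inject restrict_apply')
    have sts: "st f u = st g u" if "u \<in> words S d" for u
      using eq that by (metis (no_types, lifting) prod.inject restrict_apply')
    show "f = g"
    proof (rule aut_ext)
      fix u assume u: "u \<in> lists S"
      show "f u = g u"
      proof (cases "length u \<le> d")
        case False
        then have "u \<in> words S (d + (length u - d))"
          using u by (simp add: words_def)
        then obtain p q where "p \<in> words S d" "q \<in> words S (length u - d)" "u = p @ q"
          by (rule words_split)
        then show ?thesis
          using f g short[of p] sts[of p] state_append[of f S p q] state_append[of g S p q]
          by (simp add: words_def)
      qed (use short u in blast)
    qed (use f g in auto)
  qed
  ultimately show ?thesis
    by (rule finite_imageD)
qed

section \<open>Finitary and directed automorphisms\<close>

text \<open>These automorphisms alter only the first \<open>d\<close> letters of a word. They form a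
  copy of the automorphism group of the tree truncated at level \<open>d\<close>.\<close>

definition finitary :: "nat \<Rightarrow> ('a list \<Rightarrow> 'a list) set" where
  "finitary d = {f \<in> Aut. \<forall>w\<in>words S d. st f w = aut_one}"

lemma finitary_Aut: "f \<in> finitary d \<Longrightarrow> f \<in> Aut"
  by (simp add: finitary_def)

lemma finite_finitary: "finite (finitary d)"
  using finite_auts_with_states_in[of "{aut_one}" d] by (simp add: finitary_def)

lemma one_finitary: "aut_one \<in> finitary d"
  by (simp add: finitary_def words_lists)

lemma finitary_mult: 
  assumes "f \<in> finitary d" "g \<in> finitary d"
  shows "f \<cdot> g \<in> finitary d"
proof -
  have "st (f \<cdot> g) w = aut_one" if w: "w \<in> words S d" for w
    using assms w st_mult[of f g w] aut_words[of g w d] words_lists[OF w] by (simp add: finitary_def)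
  then show ?thesis
    using assms by (simp add: finitary_def)
qed

lemma finitary_inv: 
  assumes "f \<in> finitary d"
  shows "aut_inv f \<in> finitary d"
proof -
  have "st (aut_inv f) w = aut_one" if w: "w \<in> words S d" for w
    using assms w st_inv[of f w] aut_words[of "aut_inv f" w d] words_lists[OF w]
    by (simp add: finitary_def)
  then show ?thesis
    using assms by (simp add: finitary_def)
qed

lemma finitary_long:
  assumes f: "f \<in> finitary d" and w: "w \<in> lists S" "d \<le> length w"
  shows "st f w = aut_one"
proof -
  have "w \<in> words S (d + (length w - d))"
    using w by (simp add: words_def)
  then obtain u v where uv: "u \<in> words S d" "v \<in> words S (length w - d)" "w = u @ v"
    by (rule words_split)
  then have "st f w = st (st f u) v"
    using st_append[OF finitary_Aut[OF f] words_lists words_lists] by blast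
  then show ?thesis
    using f uv words_lists[OF uv(2)] by (simp add: finitary_def)
qed

lemma finitary_mono: "d \<le> e \<Longrightarrow> f \<in> finitary d \<Longrightarrow> f \<in> finitary e"
  using finitary_long[of f d] finitary_Aut[of f d] by (auto simp: finitary_def[of e] words_def)

lemma finitary_st:
  assumes f: "f \<in> finitary d" and w: "w \<in> lists S"
  shows "st f w \<in> finitary d"
proof -
  have "st (st f w) u = aut_one" if u: "u \<in> words S d" for u
  proof -
    have "st (st f w) u = st f (w @ u)"
      using st_append[OF finitary_Aut[OF f] w words_lists[OF u]] by simp
    then show ?thesis
      using finitary_long[OF f, of "w @ u"] u w by (simp add: words_def)
  qed
  then show ?thesis
    using st_Aut[OF finitary_Aut[OF f] w] by (simp add: finitary_def)
qed

section \<open>Rays of nonfinitary states\<close>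

definition fin :: "('a list \<Rightarrow> 'a list) \<Rightarrow> bool" where
  "fin f \<longleftrightarrow> (\<exists>d. f \<in> finitary d)"

lemma fin_st: "fin f \<Longrightarrow> w \<in> lists S \<Longrightarrow> fin (st f w)"
  using finitary_st unfolding fin_def by blast

lemma uniform_finitary:
  assumes "finite X" "\<And>f. f \<in> X \<Longrightarrow> fin f"
  shows "\<exists>d. X \<subseteq> finitary d"
proof -
  obtain h where h: "\<And>f. f \<in> X \<Longrightarrow> f \<in> finitary (h f)"
    using assms(2) unfolding fin_def by metis
  have "f \<in> finitary (Max (h ` X))" if "f \<in> X" for f
    using finitary_mono[OF _ h[OF that]] assms(1) that by simp
  then show ?thesis
    by blast
qed

text \<open>The finitely many states at level \<open>k\<close> have a common depth, to which
  \<open>k\<close> is added. In contrapositive form: below a nonfinitary state there is a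
  nonfinitary state at every level.\<close>

lemma fin_from_level:
  assumes f: "f \<in> Aut" and fin: "\<And>w. w \<in> words S k \<Longrightarrow> fin (st f w)"
  shows "fin f"
proof -
  have "\<exists>d. st f ` words S k \<subseteq> finitary d"
    by (rule uniform_finitary) (use fin finite_words in auto)
  then obtain d where d: "st f ` words S k \<subseteq> finitary d" ..
  have "st f w = aut_one" if w: "w \<in> words S (k + d)" for w
  proof -
    obtain u v where uv: "u \<in> words S k" "v \<in> words S d" "w = u @ v"
      using words_split[OF w] .
    then have "st f w = st (st f u) v"
      using st_append[OF f words_lists words_lists] by blast
    moreover have "st f u \<in> finitary d"
      using d uv(1) by blast
    ultimately show ?thesis
      using uv(2) by (simp add: finitary_def)
  qed
  then show ?thesis
    using f unfolding fin_def finitary_def by blast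
qed

text \<open>States of finitary automorphisms are finitary, so the unique words \<open>u\<close> for
  varying \<open>k\<close> are prefixes of each other: the nonfinitary states sit along one infinite
  ray from the root.\<close>

definition thin :: "('a list \<Rightarrow> 'a list) \<Rightarrow> bool" where
  "thin f \<longleftrightarrow> f \<in> Aut \<and> (\<forall>k. \<exists>!u. u \<in> words S k \<and> \<not> fin (st f u))"

definition ray :: "('a list \<Rightarrow> 'a list) \<Rightarrow> nat \<Rightarrow> 'a list" where
  "ray f k = (THE u. u \<in> words S k \<and> \<not> fin (st f u))"

definition descend :: "nat \<Rightarrow> ('a list \<Rightarrow> 'a list) \<Rightarrow> 'a list \<Rightarrow> 'a list" where
  "descend k f = st f (ray f k)"

lemma ray:
  assumes "thin f"
  shows "ray f k \<in> words S k" "\<not> fin (st f (ray f k))"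
    "\<And>u. u \<in> words S k \<Longrightarrow> \<not> fin (st f u) \<Longrightarrow> u = ray f k"
proof -
  have ex: "\<exists>!u. u \<in> words S k \<and> \<not> fin (st f u)"
    using assms by (simp add: thin_def)
  show "ray f k \<in> words S k" "\<not> fin (st f (ray f k))"
    using theI'[OF ex] unfolding ray_def by blast+
  then show "\<And>u. u \<in> words S k \<Longrightarrow> \<not> fin (st f u) \<Longrightarrow> u = ray f k"
    using ex by blast
qed

text \<open>A nonfinitary state of \<open>st f w\<close> at \<open>u\<close> is a nonfinitary state
  of \<open>f\<close> at \<open>w @ u\<close>, which must therefore lie on the ray of
  \<open>f\<close>.\<close>

lemma thin_st:
  assumes f: "thin f" and w: "w \<in> words S j" and nf: "\<not> fin (st f w)"
  shows "thin (st f w)" "w @ ray (st f w) k = ray f (j + k)"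
proof -
  have A: "f \<in> Aut"
    using f by (simp add: thin_def)
  note wl = words_lists[OF w]
  have uniq: "w @ u = ray f (j + k)" if "u \<in> words S k" "\<not> fin (st (st f w) u)" for u k
    using ray(3)[OF f append_words[OF w that(1)]] that(2) st_append[OF A wl words_lists[OF that(1)]]
    by simp
  show thin: "thin (st f w)"
    unfolding thin_def
  proof (intro conjI allI)
    fix k
    obtain u where "u \<in> words S k" "\<not> fin (st (st f w) u)"
      using fin_from_level[OF st_Aut[OF A wl], of k] nf by blast
    then show "\<exists>!u. u \<in> words S k \<and> \<not> fin (st (st f w) u)"
      using uniq by (intro ex1I[of _ u]) (auto, metis append_eq_append_conv same_append_eq)
  qed (rule st_Aut[OF A wl])
  show "w @ ray (st f w) k = ray f (j + k)"
    using uniq ray[OF thin] by blast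
qed

text \<open>Descending along the ray is an action of the additive monoid of natural numbers on thin
  automorphisms.\<close>

lemma descend_add:
  assumes f: "thin f"
  shows "thin (descend j f)" "descend (j + k) f = descend k (descend j f)"
proof -
  have A: "f \<in> Aut"
    using f by (simp add: thin_def)
  note r = ray(1)[OF f, of j] ray(2)[OF f, of j]
  show thin: "thin (descend j f)"
    unfolding descend_def by (rule thin_st(1)[OF f r])
  have "descend (j + k) f = st f (ray f j @ ray (st f (ray f j)) k)"
    using thin_st(2)[OF f r] by (simp add: descend_def)
  also have "\<dots> = descend k (descend j f)"
    using st_append[OF A words_lists[OF r(1)] words_lists[OF ray(1)[OF thin]]]
    by (simp add: descend_def)
  finally show "descend (j + k) f = descend k (descend j f)" .
qed

text \<open>There are finitely many maps from \<open>Q\<close> to \<open>Q\<close>, so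
  \<open>descend k\<close> and \<open>descend l\<close> agree on \<open>Q\<close> for some
  \<open>k < l\<close>. By \<open>descend_add\<close> the agreement propagates to all deeper levels,
  with period \<open>l - k\<close>.\<close>

lemma eventually_periodic_descend:
  assumes fin: "finite Q" and thin: "\<And>q. q \<in> Q \<Longrightarrow> thin q"
    and closed: "\<And>q k. q \<in> Q \<Longrightarrow> descend k q \<in> Q"
  shows "\<exists>k p. p \<ge> 1 \<and> (\<forall>q\<in>Q. \<forall>n\<ge>k. \<forall>t. descend (n + t * p) q = descend n q)"
proof -
  have "range (\<lambda>k. restrict (descend k) Q) \<subseteq> PiE Q (\<lambda>_. Q)"
    using closed by auto
  then have "finite (range (\<lambda>k. restrict (descend k) Q))"
    by (rule finite_subset) (use fin in \<open>simp add: finite_PiE\<close>)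
  then have "\<not> inj (\<lambda>k. restrict (descend k) Q)"
    using finite_imageD infinite_UNIV_nat by blast
  then obtain k l where kl: "k < l" "restrict (descend k) Q = restrict (descend l) Q"
    unfolding inj_def by (metis nat_neq_iff)
  have step: "descend (n + (l - k)) q = descend n q" if "q \<in> Q" "n \<ge> k" for q n
  proof -
    have "descend (k + (n - k)) q = descend (n - k) (descend k q)"
      "descend (l + (n - k)) q = descend (n - k) (descend l q)"
      using descend_add(2)[OF thin[OF that(1)]] by auto
    moreover have "descend k q = descend l q"
      using kl(2) that(1) by (metis restrict_apply')
    moreover have "k + (n - k) = n" "l + (n - k) = n + (l - k)"
      using that(2) kl(1) by auto
    ultimately show ?thesis
      by simp
  qed
  have "descend (n + t * (l - k)) q = descend n q" if "q \<in> Q" "n \<ge> k" for q n t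
  proof (induction t)
    case (Suc t)
    have "n + Suc t * (l - k) = (n + t * (l - k)) + (l - k)"
      by simp
    then show ?case
      using step[OF that(1), of "n + t * (l - k)"] that(2) Suc.IH by (metis trans_le_add1)
  qed simp
  then show ?thesis
    using kl(1) by (intro exI[of _ k] exI[of _ "l - k"]) simp
qed

text \<open>Nonfinitary states are active, so their number per level is bounded. It never decreases
  with the level, since each has a nonfinitary state below it. From a level \<open>n0\<close> with
  the maximal number on, each has exactly one at every level below.\<close>

lemma bounded_eventually_thin:
  assumes f: "f \<in> Aut" and bd: "bounded_aut S f"
  obtains n0 where "\<And>n w. n \<ge> n0 \<Longrightarrow> w \<in> words S n \<Longrightarrow> fin (st f w) \<or> thin (st f w)"
proof -
  define N where "N n = {w \<in> words S n. \<not> fin (st f w)}" for n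
  have finN: "finite (N n)" for n
    unfolding N_def using finite_words by simp
  obtain C where C: "\<And>n. card (active f n) \<le> C"
    using bd unfolding bounded_aut_active by blast
  have "fin aut_one"
    using one_finitary by (auto simp: fin_def)
  then have "N n \<subseteq> active f n" for n
    by (auto simp: N_def active_def words_def)
  then have cardN: "card (N n) \<le> C" for n
    by (rule le_trans[OF card_mono[OF finite_active] C])
  have surj: "N n = take n ` N (n + k)" for n k
  proof (intro equalityI subsetI)
    fix w assume "w \<in> N n"
    then have w: "w \<in> words S n" "\<not> fin (st f w)"
      by (simp_all add: N_def)
    obtain u where u: "u \<in> words S k" "\<not> fin (st (st f w) u)"
      using fin_from_level[OF st_Aut[OF f words_lists[OF w(1)]]] w(2) by blast
    then have "w @ u \<in> N (n + k)"
      using append_words[OF w(1) u(1)] st_append[OF f words_lists[OF w(1)] words_lists[OF u(1)]]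
      by (simp add: N_def)
    moreover have "take n (w @ u) = w"
      using w(1) by (simp add: words_def)
    ultimately show "w \<in> take n ` N (n + k)"
      by force
  next
    fix w assume "w \<in> take n ` N (n + k)"
    then obtain z where z: "z \<in> words S (n + k)" "\<not> fin (st f z)" "w = take n z"
      by (auto simp: N_def)
    obtain u v where uv: "u \<in> words S n" "v \<in> words S k" "z = u @ v"
      using words_split[OF z(1)] .
    have "st f z = st (st f u) v"
      using st_append[OF f words_lists[OF uv(1)] words_lists[OF uv(2)]] uv(3) by simp
    then have "\<not> fin (st f u)"
      using fin_st words_lists[OF uv(2)] z(2) by metis
    moreover have "w = u"
      using z(3) uv by (simp add: words_def)
    ultimately show "w \<in> N n"
      using uv(1) by (simp add: N_def)
  qed
  have "finite (range (\<lambda>n. card (N n)))"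
    by (rule finite_subset[of _ "{..C}"]) (use cardN in auto)
  then obtain n0 where n0: "card (N n) \<le> card (N n0)" for n
    using Max_in[of "range (\<lambda>n. card (N n))"] Max_ge[of "range (\<lambda>n. card (N n))"]
    by (metis (no_types, lifting) empty_iff image_iff rangeI)
  have ge: "card (N n0) \<le> card (N n)" if "n \<ge> n0" for n
    using surj[of n0 "n - n0"] that card_image_le[OF finN, of "take n0" n] by simp
  have "fin (st f w) \<or> thin (st f w)" if n: "n \<ge> n0" and w: "w \<in> words S n" for n w
  proof (cases "fin (st f w)")
    case False
    note wl = words_lists[OF w]
    have "thin (st f w)"
      unfolding thin_def
    proof (intro conjI allI)
      fix k
      \<comment> \<open>Beyond \<open>n0\<close> the counts at levels \<open>n\<close> and
        \<open>n + k\<close> agree, so truncation to length \<open>n\<close> is injective on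
        nonfinitary words.\<close>
      have "card (take n ` N (n + k)) = card (N (n + k))"
        using surj[of n k] ge[OF n] n0[of "n + k"] card_image_le[OF finN, of "take n" "n + k"] by simp
      then have inj: "inj_on (take n) (N (n + k))"
        by (rule eq_card_imp_inj_on[OF finN])
      have inN: "w @ u \<in> N (n + k)" if "u \<in> words S k" "\<not> fin (st (st f w) u)" for u
        using that append_words[OF w that(1)] st_append[OF f wl words_lists[OF that(1)]]
        by (simp add: N_def)
      have tk: "take n (w @ u) = w" for u
        using w by (simp add: words_def)
      obtain u where u: "u \<in> words S k" "\<not> fin (st (st f w) u)"
        using fin_from_level[OF st_Aut[OF f wl], of k] False by blast
      have "u' = u" if "u' \<in> words S k" "\<not> fin (st (st f w) u')" for u'
      proof -
        have "w @ u' = w @ u"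
          by (rule inj_onD[OF inj]) (simp_all only: tk inN[OF that] inN[OF u])
        then show ?thesis
          by simp
      qed
      with u show "\<exists>!u. u \<in> words S k \<and> \<not> fin (st (st f w) u)"
        by blast
    qed (rule st_Aut[OF f wl])
    then show ?thesis ..
  qed simp
  then show ?thesis
    by (rule that)
qed

text \<open>The equation \<open>st f v = f\<close> makes \<open>f\<close> self-similar along the ray
  that repeats \<open>v\<close>. The identity is included, so that the directed automorphisms form a
  groupoid below.\<close>

definition directed :: "nat \<Rightarrow> 'a list \<Rightarrow> ('a list \<Rightarrow> 'a list) set" where
  "directed m v = {f \<in> Aut. st f v = f \<and> (\<forall>y\<in>words S m. y \<noteq> v \<longrightarrow> st f y \<in> finitary m)}"

definition tame :: "nat \<Rightarrow> ('a list \<Rightarrow> 'a list) \<Rightarrow> bool" where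
  "tame m s \<longleftrightarrow> s \<in> Aut \<and>
     (\<forall>w\<in>words S m. st s w \<in> finitary m \<or> (\<exists>v\<in>words S m. st s w \<in> directed m v))"

text \<open>Deep states are finitary or thin. There are finitely many states, so the finitary ones
  have a common depth, and descending along the rays of the thin ones is eventually periodic. A
  suitable multiple of the period makes a thin state at level \<open>m\<close> recur
  \<open>m\<close> levels further down its ray.\<close>

lemma bounded_automatic_tame:
  assumes finT: "finite T"
    and T: "\<And>s. s \<in> T \<Longrightarrow> s \<in> Aut \<and> bounded_aut S s \<and> automatic S s"
  obtains m where "m \<ge> 1" "\<And>s. s \<in> T \<Longrightarrow> tame m s"
proof -
  define Q where "Q = {st s w | s w. s \<in> T \<and> w \<in> lists S}"
  have "Q = (\<Union>s\<in>T. {st s w | w. w \<in> lists S})"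
    unfolding Q_def by blast
  then have finQ: "finite Q"
    using finT T by (simp add: automatic_def)
  have Q_st: "st q u \<in> Q" if q: "q \<in> Q" and u: "u \<in> lists S" for q u
  proof -
    obtain s w where sw: "q = st s w" "s \<in> T" "w \<in> lists S"
      using q unfolding Q_def by blast
    then have "st q u = st s (w @ u)"
      using st_append[of s w u] T u by simp
    moreover have "w @ u \<in> lists S"
      using sw u by simp
    ultimately show ?thesis
      unfolding Q_def using sw by blast
  qed
  have "\<forall>s\<in>T. \<exists>n0. \<forall>n\<ge>n0. \<forall>w\<in>words S n. fin (st s w) \<or> thin (st s w)"
    using bounded_eventually_thin T by metis
  then obtain n1 where n1: "\<And>s n w. s \<in> T \<Longrightarrow> n \<ge> n1 s \<Longrightarrow> w \<in> words S n \<Longrightarrow>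
      fin (st s w) \<or> thin (st s w)"
    by metis
  define n0 where "n0 = Max (insert 0 (n1 ` T))"
  have n0: "fin (st s w) \<or> thin (st s w)" if "s \<in> T" "w \<in> words S n0" for s w
    using n1[OF that(1) _ that(2)] finT that(1) by (simp add: n0_def)
  have "\<exists>d. {q \<in> Q. fin q} \<subseteq> finitary d"
    by (rule uniform_finitary) (use finQ in simp_all)
  then obtain d where d: "\<And>q. q \<in> Q \<Longrightarrow> fin q \<Longrightarrow> q \<in> finitary d"
    by blast
  let ?Q1 = "{q \<in> Q. thin q}"
  have closed: "descend k q \<in> ?Q1" if "q \<in> ?Q1" for q k
  proof -
    have "thin q" "q \<in> Q"
      using that by simp_all
    then have "descend k q \<in> Q" "thin (descend k q)"
      using Q_st[OF _ words_lists[OF ray(1)], of q q k] descend_add(1)[of q k]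
      by (simp_all add: descend_def)
    then show ?thesis
      by simp
  qed
  have "\<exists>k p. p \<ge> 1 \<and> (\<forall>q\<in>?Q1. \<forall>n\<ge>k. \<forall>t. descend (n + t * p) q = descend n q)"
    by (rule eventually_periodic_descend) (use finQ in simp, simp, rule closed)
  then obtain k p where kp: "p \<ge> 1"
    "\<And>q n t. q \<in> ?Q1 \<Longrightarrow> n \<ge> k \<Longrightarrow> descend (n + t * p) q = descend n q"
    by blast
  \<comment> \<open>\<open>m\<close> is a multiple of the period \<open>p\<close>. It exceeds
    \<open>n0\<close>, where states become finitary or thin, by at least the preperiod
    \<open>k\<close>, and it is at least the common depth \<open>d\<close>; the summand 1 makes it
    positive.\<close>
  define m where "m = (n0 + k + d + 1) * p"
  have m: "m \<ge> n0 + k + d + 1"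
    using mult_le_mono2[OF kp(1), of "n0 + k + d + 1"] unfolding m_def by simp
  have "tame m s" if s: "s \<in> T" for s
    unfolding tame_def
  proof (intro conjI ballI)
    show A: "s \<in> Aut"
      using T s by blast
    fix w assume w: "w \<in> words S m"
    let ?r = "st s w"
    have rQ: "?r \<in> Q"
      unfolding Q_def using s words_lists[OF w] by blast
    show "?r \<in> finitary m \<or> (\<exists>v\<in>words S m. ?r \<in> directed m v)"
    proof (cases "fin ?r")
      case True
      then show ?thesis
        using d[of ?r] rQ finitary_mono[of d m] m by simp
    next
      case False
      have "w \<in> words S (n0 + (m - n0))"
        using w m by simp
      then obtain w1 w2 where ws: "w1 \<in> words S n0" "w2 \<in> words S (m - n0)" "w = w1 @ w2"
        by (rule words_split)
      have r: "?r = st (st s w1) w2"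
        using st_append[OF A words_lists[OF ws(1)] words_lists[OF ws(2)]] ws(3) by simp
      then have "\<not> fin (st s w1)"
        using False fin_st words_lists[OF ws(2)] by metis
      then have thin1: "thin (st s w1)"
        using n0[OF s ws(1)] by blast
      have Q1: "st s w1 \<in> ?Q1"
        using thin1 s words_lists[OF ws(1)] unfolding Q_def by blast
      have "w2 = ray (st s w1) (m - n0)"
        using ray(3)[OF thin1 ws(2)] False r by simp
      then have rd: "?r = descend (m - n0) (st s w1)"
        using r by (simp add: descend_def)
      have thin: "thin ?r"
        using descend_add(1)[OF thin1] rd by simp
      \<comment> \<open>\<open>?r\<close> lies \<open>m - n0 \<ge> k\<close> levels down a ray, and
        \<open>m\<close> is \<open>n0 + k + d + 1\<close> periods.\<close>
      have "descend m ?r = ?r"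
        using descend_add(2)[OF thin1, of "m - n0" m] kp(2)[OF Q1, of "m - n0" "n0 + k + d + 1"] rd m
        by (simp add: m_def)
      then have "st ?r (ray ?r m) = ?r"
        by (simp add: descend_def)
      moreover have "st ?r y \<in> finitary m" if "y \<in> words S m" "y \<noteq> ray ?r m" for y
      proof -
        have "fin (st ?r y)"
          using ray(3)[OF thin that(1)] that(2) by blast
        then show ?thesis
          using d[of "st ?r y"] Q_st[OF rQ words_lists[OF that(1)]] finitary_mono[of d m] m by simp
      qed
      ultimately have "?r \<in> directed m (ray ?r m)"
        using st_Aut[OF A words_lists[OF w]] by (simp add: directed_def)
      then show ?thesis
        using ray(1)[OF thin] by blast
    qed
  qed
  then show ?thesis
    using that[of m] m by simp
qed

section \<open>The action on words of blocks\<close>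

definition blocks :: "nat \<Rightarrow> nat \<Rightarrow> 'a list list set" where
  "blocks m K = {us. length us = K \<and> set us \<subseteq> words S m}"

lemma finite_blocks: "finite (blocks m K)"
  using finite_lists_length_eq[OF finite_words[of m], of K]
  by (simp add: blocks_def conj_commute)

lemma blocks_Cons: "y # us \<in> blocks m K \<longleftrightarrow> y \<in> words S m \<and> (\<exists>k. K = Suc k \<and> us \<in> blocks m k)"
  by (auto simp: blocks_def)

lemma concat_blocks: "us \<in> blocks m K \<Longrightarrow> concat us \<in> words S (m * K)"
proof (induction us arbitrary: K)
  case (Cons y us)
  then obtain k where k: "y \<in> words S m" "K = Suc k" "us \<in> blocks m k"
    by (auto simp: blocks_Cons)
  then show ?case
    using append_words[OF k(1) Cons.IH[OF k(3)]] by simp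
qed (simp add: blocks_def words_def)

lemma words_concat_blocks: "w \<in> words S (m * K) \<Longrightarrow> \<exists>us\<in>blocks m K. w = concat us"
proof (induction K arbitrary: w)
  case 0
  then show ?case
    by (intro bexI[of _ "[]"]) (simp_all add: words_def blocks_def)
next
  case (Suc K)
  then have "w \<in> words S (m + m * K)"
    by simp
  then obtain u v where uv: "u \<in> words S m" "v \<in> words S (m * K)" "w = u @ v"
    by (rule words_split)
  obtain us where "us \<in> blocks m K" "v = concat us"
    using Suc.IH[OF uv(2)] by blast
  then show ?case
    using uv by (intro bexI[of _ "u # us"]) (simp_all add: blocks_Cons)
qed

text \<open>\<open>f\<close> is run as a transducer whose state passes from block to block. By
  \<open>concat_act\<close> this is the usual action on words, in a form that keeps the blocks
  visible for \<open>ell\<close>.\<close>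

fun act :: "('a list \<Rightarrow> 'a list) \<Rightarrow> 'a list list \<Rightarrow> 'a list list" where
  "act f [] = []"
| "act f (y # us) = f y # act (st f y) us"

lemma act_length [simp]: "length (act f us) = length us"
  by (induction f us rule: act.induct) simp_all

lemma act_blocks: "f \<in> Aut \<Longrightarrow> us \<in> blocks m K \<Longrightarrow> act f us \<in> blocks m K"
proof (induction us arbitrary: f K)
  case (Cons y us)
  then obtain k where k: "y \<in> words S m" "K = Suc k" "us \<in> blocks m k"
    by (auto simp: blocks_Cons)
  then show ?case
    using Cons.IH[OF st_Aut[OF Cons.prems(1) words_lists[OF k(1)]] k(3)] Cons.prems(1)
    by (simp add: blocks_Cons)
qed (simp add: blocks_def)

lemma concat_act: "f \<in> Aut \<Longrightarrow> us \<in> blocks m K \<Longrightarrow> concat (act f us) = f (concat us)"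
proof (induction us arbitrary: f K)
  case (Cons y us)
  then obtain k where k: "y \<in> words S m" "K = Suc k" "us \<in> blocks m k"
    by (auto simp: blocks_Cons)
  then show ?case
    using Cons.IH[OF st_Aut[OF Cons.prems(1) words_lists[OF k(1)]] k(3)]
      state_append[OF Cons.prems(1) words_lists[OF k(1)] words_lists[OF concat_blocks[OF k(3)]]]
    by simp
qed simp

lemma act_inj: "f \<in> Aut \<Longrightarrow> us \<in> blocks m K \<Longrightarrow> us' \<in> blocks m K \<Longrightarrow> act f us = act f us' \<Longrightarrow> us = us'"
proof (induction us arbitrary: f K us')
  case Nil
  then show ?case
    by (simp add: blocks_def)
next
  case (Cons y us)
  then obtain k where k: "y \<in> words S m" "K = Suc k" "us \<in> blocks m k"
    by (auto simp: blocks_Cons)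
  with Cons.prems(3) obtain y' vs where vs: "us' = y' # vs"
    by (cases us') (simp_all add: blocks_def)
  then have k': "y' \<in> words S m" "vs \<in> blocks m k"
    using Cons.prems(3) k(2) by (auto simp: blocks_Cons)
  have "f y = f y'"
    using Cons.prems(4) vs by simp
  then have "y = y'"
    using inj_onD[OF aut_inj[OF Cons.prems(1)] _ words_lists[OF k(1)] words_lists[OF k'(1)]] by simp
  then show ?case
    using Cons.IH[OF st_Aut[OF Cons.prems(1) words_lists[OF k(1)]] k(3) k'(2)] Cons.prems(4) vs
    by simp
qed

lemma act_bij: "f \<in> Aut \<Longrightarrow> bij_betw (act f) (blocks m K) (blocks m K)"
proof -
  assume f: "f \<in> Aut"
  have inj: "inj_on (act f) (blocks m K)"
    by (rule inj_onI) (rule act_inj[OF f])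
  moreover have "act f ` blocks m K \<subseteq> blocks m K"
    using act_blocks[OF f] by blast
  ultimately show ?thesis
    using endo_inj_surj[OF finite_blocks] by (auto simp: bij_betw_def)
qed

lemma act_one: "us \<in> blocks m K \<Longrightarrow> act aut_one us = us"
proof (induction us arbitrary: K)
  case (Cons y us)
  then obtain k where "y \<in> words S m" "us \<in> blocks m k"
    by (auto simp: blocks_Cons)
  then show ?case
    using Cons.IH words_lists[of y S m] by simp
qed simp

lemma act_finitary:
  assumes "a \<in> finitary m" "y # us \<in> blocks m K"
  shows "act a (y # us) = a y # us"
  using assms act_one by (auto simp: blocks_Cons finitary_def)

section \<open>How far the action changes the final constant run\<close>

text \<open>\<open>ell us\<close> is the number of entries before the final constant run of \<open>us\<close>.\<close>

fun ell :: "'b list \<Rightarrow> nat" where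
  "ell [] = 0"
| "ell (y # us) = (if set us \<subseteq> {y} then 0 else Suc (ell us))"

lemma ell_0_iff: "ell us = 0 \<longleftrightarrow> (\<exists>v. set us \<subseteq> {v})"
  by (cases us) auto

lemma ell_Cons_le: "ell (y # us) \<le> Suc (ell us)"
  by simp

lemma ell_Cons: "ell us \<noteq> 0 \<Longrightarrow> ell (y # us) = Suc (ell us)"
  unfolding ell_0_iff by auto

lemma set_replicate_conv: "set us \<subseteq> {v} \<longleftrightarrow> us = replicate (length us) v"
  by (metis replicate_eqI set_replicate_conv_if subset_singleton_iff empty_subsetI singleton_iff subsetD order_refl)

lemma directed_Aut: "b \<in> directed m v \<Longrightarrow> b \<in> Aut"
  by (simp add: directed_def)

lemma act_directed_eq: "b \<in> directed m v \<Longrightarrow> act b (v # us) = b v # act b us"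
  by (simp add: directed_def)

lemma directed_neq:
  "b \<in> directed m v \<Longrightarrow> v \<in> words S m \<Longrightarrow> y \<in> words S m \<Longrightarrow> y \<noteq> v \<Longrightarrow> b y \<noteq> b v"
  using inj_onD[OF aut_inj[OF directed_Aut[of b m v]], of y v] words_lists by blast

text \<open>The state remains \<open>b\<close> while blocks \<open>v\<close> are read, and the first
  block different from \<open>v\<close> is not mapped to \<open>b v\<close>.\<close>

lemma act_directed_const:
  assumes b: "b \<in> directed m v" and v: "v \<in> words S m"
  shows "us \<in> blocks m k \<Longrightarrow> set (act b us) \<subseteq> {b v} \<longleftrightarrow> set us \<subseteq> {v}"
proof (induction us arbitrary: k)
  case (Cons y us)
  then obtain l where k: "y \<in> words S m" "us \<in> blocks m l"
    by (auto simp: blocks_Cons)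
  show ?case
  proof (cases "y = v")
    case True
    then show ?thesis
      using Cons.IH[OF k(2)] act_directed_eq[OF b, of us] by simp
  next
    case False
    then show ?thesis
      using directed_neq[OF b v k(1)] by simp
  qed
qed simp

text \<open>\<open>a\<close> changes only \<open>z\<close> and leaves \<open>r\<close> alone. If
  \<open>r\<close> is not constant, the two blocks before it count on both sides; otherwise both
  values are at most 2.\<close>

lemma finitary_second_block:
  assumes "a \<in> finitary m" "z # r \<in> blocks m k"
  shows "ell (y' # act a (z # r)) = ell (y # z # r) \<or>
    ell (y # z # r) \<le> 2 \<and> ell (y' # act a (z # r)) \<le> 2 \<and> (\<exists>v. set r \<subseteq> {v})"
proof (cases "ell r = 0")
  case True
  have "ell (y # z # r) \<le> 2" "ell (y' # a z # r) \<le> 2"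
    using True ell_Cons_le[of y "z # r"] ell_Cons_le[of z r]
      ell_Cons_le[of y' "a z # r"] ell_Cons_le[of "a z" r] by linarith+
  then show ?thesis
    using True act_finitary[OF assms] unfolding ell_0_iff by (simp only: simp_thms)
next
  case False
  then have "ell (y # z # r) = Suc (Suc (ell r))" "ell (y' # a z # r) = Suc (Suc (ell r))"
    using ell_Cons by (metis nat.distinct(1))+
  then show ?thesis
    using act_finitary[OF assms] by (simp only: simp_thms)
qed

text \<open>While blocks \<open>v\<close> are read the state remains \<open>b\<close>. After the
  first other block it is finitary, so only one further block can change. Hence \<open>ell\<close>
  can change only if the rest is constant, and the leading blocks \<open>v\<close> then add the same
  number to both values.\<close>

lemma ell_act_directed:
  assumes b: "b \<in> directed m v" and v: "v \<in> words S m"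
  shows "us \<in> blocks m k \<Longrightarrow> ell (act b us) = ell us \<or>
    ell us \<le> ell (act b us) + 2 \<and> ell (act b us) \<le> ell us + 2 \<and>
    (\<exists>i y z c j. us = replicate i v @ y # z # replicate j c \<and> {y, z, c} \<subseteq> words S m)"
proof (induction us arbitrary: k)
  case (Cons y us)
  then obtain l where k: "y \<in> words S m" "us \<in> blocks m l"
    by (auto simp: blocks_Cons)
  show ?case
  proof (cases "y = v")
    case True
    show ?thesis
    proof (cases "set us \<subseteq> {v}")
      case t: True
      then show ?thesis
        using True act_directed_eq[OF b, of us] act_directed_const[OF b v k(2)] by simp
    next
      case False
      then have e: "ell (y # us) = Suc (ell us)" "ell (act b (y # us)) = Suc (ell (act b us))"
        using True act_directed_eq[OF b, of us] act_directed_const[OF b v k(2)] by simp_all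
      from Cons.IH[OF k(2)] show ?thesis
      proof (elim disjE conjE exE)
        fix i y' z c j
        assume "us = replicate i v @ y' # z # replicate j c" and "{y', z, c} \<subseteq> words S m"
        then have "\<exists>i y' z c j. y # us = replicate i v @ y' # z # replicate j c \<and> {y', z, c} \<subseteq> words S m"
          using True by (intro exI[of _ "Suc i"]) auto
        moreover assume "ell us \<le> ell (act b us) + 2" "ell (act b us) \<le> ell us + 2"
        ultimately show ?thesis
          unfolding e by simp
      qed (use e in simp)
    qed
  next
    case False
    then have a: "st b y \<in> finitary m"
      using b k(1) by (simp add: directed_def)
    show ?thesis
    proof (cases us)
      case (Cons z r)
      have zr: "z # r \<in> blocks m l"
        using k(2) Cons by simp
      then have zw: "z \<in> words S m" "set r \<subseteq> words S m"
        by (auto simp: blocks_def)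
      have *: "act b (y # z # r) = b y # act (st b y) (z # r)"
        by simp
      from finitary_second_block[OF a zr, of "b y" y] show ?thesis
      proof (elim disjE conjE exE)
        fix c assume c: "set r \<subseteq> {c}"
        then have r: "r = replicate (length r) c"
          using set_replicate_conv by metis
        have "\<exists>c j. r = replicate j c \<and> c \<in> words S m"
        \<comment> \<open>For an empty tail any word of length \<open>m\<close> serves as
          \<open>c\<close>; \<open>z\<close> is at hand.\<close>
        proof (cases "r = []")
          case True
          then show ?thesis
            using zw by (intro exI[of _ z] exI[of _ 0]) simp
        next
          case False
          then have "c \<in> set r"
            using c by (cases r) auto
          then show ?thesis
            using r zw by blast
        qed
        then obtain c' j where "r = replicate j c'" "c' \<in> words S m"
          by blast
        then have "\<exists>i y' z c j. y # us = replicate i v @ y' # z # replicate j c \<and> {y', z, c} \<subseteq> words S m"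
          using Cons k zw by (intro exI[of _ 0]) auto
        moreover assume "ell (y # z # r) \<le> 2" "ell (b y # act (st b y) (z # r)) \<le> 2"
        then have "ell (y # z # r) \<le> ell (b y # act (st b y) (z # r)) + 2"
          "ell (b y # act (st b y) (z # r)) \<le> ell (y # z # r) + 2"
          by linarith+
        ultimately show ?thesis
          unfolding Cons * by blast
      qed (simp only: * Cons simp_thms)
    qed simp
  qed
qed simp

text \<open>The first block \<open>x\<close> leads to a finitary or a directed state, to which the
  preceding lemmas apply. The bound 3 reappears as the threshold below which \<open>angle\<close> is
  constant.\<close>

lemma ell_act_tame:
  assumes s: "tame m s" and us: "us \<in> blocks m K"
  shows "ell (act s us) = ell us \<or> ell us \<le> 3 \<and> ell (act s us) \<le> 3 \<or>
    ell us \<le> ell (act s us) + 2 \<and> ell (act s us) \<le> ell us + 2 \<and>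
    (\<exists>x i v y z c j. us = x # replicate i v @ y # z # replicate j c \<and> {x, v, y, z, c} \<subseteq> words S m)"
proof (cases us)
  case (Cons x r)
  then obtain l where k: "x \<in> words S m" "r \<in> blocks m l"
    using us by (auto simp: blocks_Cons)
  have act: "act s us = s x # act (st s x) r"
    using Cons by simp
  consider "st s x \<in> finitary m" | v where "v \<in> words S m" "st s x \<in> directed m v"
    using s k(1) unfolding tame_def by blast
  then show ?thesis
  proof cases
    case 1
    show ?thesis
    proof (cases r)
      case (Cons z r')
      then have "ell (act s us) = ell us \<or> ell us \<le> 2 \<and> ell (act s us) \<le> 2"
        using finitary_second_block[OF 1, of z r' l "s x" x] k(2) act \<open>us = x # r\<close> by metis
      then show ?thesis
        by linarith
    qed (use Cons in simp)
  next
    case 2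
    note dir = ell_act_directed[OF 2(2,1) k(2)]
    show ?thesis
    \<comment> \<open>If one of the two tails is constant, the first block may count on one side
      only and the difference could exceed 2. Both values are then at most 3.\<close>
    proof (cases "ell r = 0 \<or> ell (act (st s x) r) = 0")
      case True
      then have "ell r \<le> 2" "ell (act (st s x) r) \<le> 2"
        using dir by auto
      then have "ell us \<le> 3" "ell (act s us) \<le> 3"
        using ell_Cons_le[of x r] ell_Cons_le[of "s x" "act (st s x) r"]
        unfolding act unfolding Cons by linarith+
      then show ?thesis
        by blast
    next
      case False
      then have e: "ell us = Suc (ell r)" "ell (act s us) = Suc (ell (act (st s x) r))"
        unfolding act unfolding Cons using ell_Cons[of r x] ell_Cons[of "act (st s x) r" "s x"] by blast+
      from dir show ?thesis
      proof (elim disjE conjE exE)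
        fix i y z c j
        assume "r = replicate i v @ y # z # replicate j c" "{y, z, c} \<subseteq> words S m"
        then have "us = x # replicate i v @ y # z # replicate j c" "{x, v, y, z, c} \<subseteq> words S m"
          using Cons k(1) 2(1) by auto
        then have "\<exists>x i v y z c j. us = x # replicate i v @ y # z # replicate j c \<and>
            {x, v, y, z, c} \<subseteq> words S m"
          by blast
        moreover assume "ell r \<le> ell (act (st s x) r) + 2" "ell (act (st s x) r) \<le> ell r + 2"
        ultimately show ?thesis
          unfolding e by simp
      qed (use e in simp)
    qed
  qed
qed simp

text \<open>Such a word is given by the position \<open>i\<close> and five blocks; its length
  \<open>K\<close> forces the final exponent \<open>j = K - 3 - i\<close>. The count is therefore
  linear in \<open>K\<close>, although the number of all words may grow exponentially.\<close>

lemma card_changed: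
  assumes s: "tame m s"
  shows "card {us \<in> blocks m K. ell (act s us) \<noteq> ell us \<and> \<not> (ell us \<le> 3 \<and> ell (act s us) \<le> 3)}
    \<le> K * card (words S m) ^ 5" (is "card ?D \<le> _")
proof -
  let ?X = "words S m"
  let ?P = "{..<K} \<times> ?X \<times> ?X \<times> ?X \<times> ?X \<times> ?X"
  let ?h = "\<lambda>(i, x, v, y, z, c). x # replicate i v @ y # z # replicate (K - 3 - i) c"
  have "?D \<subseteq> ?h ` ?P"
  proof
    fix us assume us: "us \<in> ?D"
    then have "us \<in> blocks m K"
      by simp
    from ell_act_tame[OF s this] us obtain x i v y z c j where
      x: "us = x # replicate i v @ y # z # replicate j c" "{x, v, y, z, c} \<subseteq> ?X"
      by blast
    have "length us = K"
      using us by (simp add: blocks_def)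
    then have "j = K - 3 - i" "i < K"
      using x(1) by auto
    then show "us \<in> ?h ` ?P"
      using x by (intro image_eqI[of _ _ "(i, x, v, y, z, c)"]) auto
  qed
  moreover have "finite ?P"
    using finite_words by simp
  ultimately have "card ?D \<le> card ?P"
    by (rule surj_card_le[rotated])
  also have "card ?P = K * card ?X ^ 5"
    by (simp add: card_cartesian_product numeral_eq_Suc)
  finally show ?thesis .
qed

text \<open>Either all blocks are \<open>v\<close> and the state stays \<open>b\<close>; or at least
  two blocks follow the first one different from \<open>v\<close>, so the state has become trivial
  and the last block is untouched; or that block is one of the last two, and the final constant run
  of the image has length at most 2.\<close>

lemma act_directed_trichotomy:
  assumes b: "b \<in> directed m v" and v: "v \<in> words S m"
  shows "us \<in> blocks m k \<Longrightarrow>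
    us = replicate k v \<and> act b us = replicate k (b v) \<and> st b (concat us) = b \<or>
    us \<noteq> [] \<and> st b (concat us) = aut_one \<and> last (act b us) = last us \<or>
    st b (concat us) \<in> finitary m \<and> k \<le> ell (act b us) + 2"
proof (induction us arbitrary: k)
  case Nil
  then show ?case
    using st_Nil[OF directed_Aut[OF b]] by (simp add: blocks_def)
next
  case (Cons y us)
  then obtain l where k: "y \<in> words S m" "k = Suc l" "us \<in> blocks m l"
    by (auto simp: blocks_Cons)
  have split: "st b (concat (y # us)) = st (st b y) (concat us)"
    using st_append[OF directed_Aut[OF b] words_lists[OF k(1)] words_lists[OF concat_blocks[OF k(3)]]]
    by simp
  show ?case
  proof (cases "y = v")
    case True
    have st: "st b (concat (y # us)) = st b (concat us)"
      using split True b by (simp add: directed_def)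
    have act: "act b (y # us) = b v # act b us"
      using True act_directed_eq[OF b] by simp
    show ?thesis
    proof (cases "set us \<subseteq> {v}")
      case t: True
      have len: "length us = l"
        using k(3) by (simp add: blocks_def)
      have "us = replicate l v"
        using t set_replicate_conv[of us v] unfolding len by blast
      moreover have "act b us = replicate l (b v)"
        using t act_directed_const[OF b v k(3)] set_replicate_conv[of "act b us" "b v"]
        unfolding act_length len by blast
      moreover have "st b (concat us) = b" if "set us \<subseteq> {v}" for us
        using that
      proof (induction us)
        case (Cons z us)
        then have "z = v" "concat us \<in> lists S"
          using words_lists[OF v] by fastforce+
        then show ?case
          using Cons st_append[OF directed_Aut[OF b] words_lists[OF v], of "concat us"] b
          by (simp add: directed_def)
      qed (use st_Nil[OF directed_Aut[OF b]] in simp)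
      ultimately show ?thesis
        using st act True k(2) t by simp
    next
      case False
      have e: "ell (b v # act b us) = Suc (ell (act b us))"
        using False act_directed_const[OF b v k(3)] by simp
      from Cons.IH[OF k(3)] show ?thesis
      proof (elim disjE conjE)
        assume "us = replicate l v"
        then have "set us \<subseteq> {v}"
          by auto
        with False show ?thesis ..
      next
        assume "us \<noteq> []" "st b (concat us) = aut_one" "last (act b us) = last us"
        moreover from this(1) have "act b us \<noteq> []"
          by (metis act_length length_0_conv)
        ultimately show ?thesis
          unfolding st act by simp
      next
        assume "st b (concat us) \<in> finitary m" "l \<le> ell (act b us) + 2"
        then show ?thesis
          unfolding st act e k(2) by simp
      qed
    qed
  next
    case False
    then have a: "st b y \<in> finitary m"
      using b k(1) by (simp add: directed_def)
    show ?thesis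
    proof (cases us)
      case Nil
      then show ?thesis
        using a split st_Nil[OF finitary_Aut[OF a]] k by (simp add: blocks_def)
    next
      case (Cons z r)
      then have z: "z \<in> words S m" "r \<in> blocks m (l - 1)"
        using k(3) by (auto simp: blocks_Cons)
      have "st (st b y) (concat us) = st (st (st b y) z) (concat r)"
        using st_append[OF finitary_Aut[OF a] words_lists[OF z(1)] words_lists[OF concat_blocks[OF z(2)]]]
          Cons by simp
      also have "\<dots> = aut_one"
        using a z(1) words_lists[OF concat_blocks[OF z(2)]] by (simp add: finitary_def)
      finally have one: "st b (concat (y # us)) = aut_one"
        using split by simp
      show ?thesis
      \<comment> \<open>If \<open>z\<close> is the last block, \<open>a\<close> may change it and
        the second alternative can fail; the third one then holds because
        \<open>k = 2\<close>.\<close>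
      proof (cases "r = []")
        case True
        then have "k = 2"
          using k Cons by (auto simp: blocks_def)
        then show ?thesis
          using one one_finitary by simp
      next
        case False
        then have "last (act b (y # us)) = last (y # us)"
          using act_finitary[OF a] k(3) Cons by simp
        then show ?thesis
          using one by simp
      qed
    qed
  qed
qed

text \<open>One initial block is added to the preceding trichotomy. The cases are those of
  \<open>cell_mult_iff\<close>: the image lies in \<open>E\<close>, the state of \<open>s\<close> is
  trivial, or the image lies outside \<open>E\<close>.\<close>

lemma act_tame_trichotomy:
  assumes s: "tame m s" and us: "us \<in> blocks m K" and K: "5 \<le> K"
  shows "(\<exists>v\<in>words S m. st s (concat us) \<in> directed m v \<and> last us = v \<and>
        last (act s us) = st s (concat us) v \<and> ell (act s us) \<le> 1) \<or>
    st s (concat us) = aut_one \<and> last (act s us) = last us \<or>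
    st s (concat us) \<in> finitary m \<and> K \<le> ell (act s us) + 2"
proof -
  obtain x r where xr: "us = x # r"
    using us K by (cases us) (auto simp: blocks_def)
  then have k: "x \<in> words S m" "r \<in> blocks m (K - 1)"
    using us by (auto simp: blocks_Cons)
  have A: "s \<in> Aut"
    using s by (simp add: tame_def)
  have act: "act s us = s x # act (st s x) r"
    using xr by simp
  have rne: "r \<noteq> []" "act (st s x) r \<noteq> []"
    using k(2) K length_0_conv[of "act (st s x) r"] unfolding act_length by (auto simp: blocks_def)
  have st: "st s (concat us) = st (st s x) (concat r)"
    using st_append[OF A words_lists[OF k(1)] words_lists[OF concat_blocks[OF k(2)]]] xr by simp
  consider "st s x \<in> finitary m" | v where "v \<in> words S m" "st s x \<in> directed m v"
    using s k(1) unfolding tame_def by blast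
  then show ?thesis
  proof cases
    case 1
    obtain z r' where z: "r = z # r'"
      using rne by (cases r) auto
    then have zw: "z \<in> words S m" "r' \<in> blocks m (K - 2)"
      using k(2) by (auto simp: blocks_def)
    have r': "r' \<noteq> []"
      using zw(2) K by (auto simp: blocks_def)
    have "st (st s x) (concat r) = st (st (st s x) z) (concat r')"
      using st_append[OF finitary_Aut[OF 1] words_lists[OF zw(1)] words_lists[OF concat_blocks[OF zw(2)]]]
        z by simp
    also have "\<dots> = aut_one"
      using 1 zw(1) words_lists[OF concat_blocks[OF zw(2)]] by (simp add: finitary_def)
    finally have "st s (concat us) = aut_one"
      using st by simp
    moreover have "last (act s us) = last us"
      using act_finitary[OF 1] k(2) r' xr z by simp
    ultimately show ?thesis
      by blast
  next
    case 2
    from act_directed_trichotomy[OF 2(2,1) k(2)] show ?thesis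
    proof (elim disjE conjE)
      assume *: "r = replicate (K - 1) v" "act (st s x) r = replicate (K - 1) (st s x v)"
        "st (st s x) (concat r) = st s x"
      have "ell (act s us) \<le> 1"
        using ell_Cons_le[of "s x" "act (st s x) r"] ell_0_iff[of "act (st s x) r"] act *(2) by force
      moreover have "last us = v" "last (act s us) = st s x v"
        using xr act * K by simp_all
      ultimately show ?thesis
        using 2 st *(3) by auto
    next
      assume "st (st s x) (concat r) = aut_one" "last (act (st s x) r) = last r"
      then show ?thesis
        using st act xr rne by simp
    next
      assume *: "st (st s x) (concat r) \<in> finitary m" "K - 1 \<le> ell (act (st s x) r) + 2"
      \<comment> \<open>A positive value means that the first block adds exactly one, which carries
        the bound from \<open>K - 1\<close> to \<open>K\<close>; here \<open>5 \<le> K\<close>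
        enters.\<close>
      then have "ell (act (st s x) r) \<noteq> 0"
        using K by linarith
      then have "K \<le> ell (act s us) + 2"
        using ell_Cons[of "act (st s x) r" "s x"] *(2) unfolding act by linarith
      then show ?thesis
        unfolding st using *(1) by blast
    qed
  qed
qed

section \<open>The groupoid of directed automorphisms\<close>

lemma one_directed: "v \<in> words S m \<Longrightarrow> aut_one \<in> directed m v"
  by (simp add: directed_def words_lists one_finitary)

text \<open>An element \<open>b\<close> of \<open>directed m v\<close> is an arrow from
  \<open>v\<close> to \<open>b v\<close>, and this is composition of arrows. Words other than
  \<open>v\<close> are mapped to words other than \<open>b v\<close>, where \<open>g\<close> has
  finitary states as well.\<close>

lemma directed_mult:
  assumes b: "b \<in> directed m v" and v: "v \<in> words S m" and g: "g \<in> directed m (b v)"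
  shows "g \<cdot> b \<in> directed m v"
proof -
  note A = directed_Aut[OF b] directed_Aut[OF g]
  have "st (g \<cdot> b) v = g \<cdot> b"
    using st_mult[OF A(2,1) words_lists[OF v]] b g by (simp add: directed_def)
  moreover have "st (g \<cdot> b) y \<in> finitary m" if y: "y \<in> words S m" "y \<noteq> v" for y
  proof -
    have "st g (b y) \<in> finitary m" "st b y \<in> finitary m"
      using directed_neq[OF b v y] b g y A by (simp_all add: directed_def)
    then show ?thesis
      using st_mult[OF A(2,1) words_lists[OF y(1)]] finitary_mult by simp
  qed
  ultimately show ?thesis
    using A by (simp add: directed_def)
qed

lemma directed_inv:
  assumes b: "b \<in> directed m v" and v: "v \<in> words S m"
  shows "aut_inv b \<in> directed m (b v)"
proof -
  note A = directed_Aut[OF b]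
  have bv: "b v \<in> lists S"
    using A words_lists[OF v] by simp
  have "st (aut_inv b) (b v) = aut_inv b"
    using st_inv[OF A bv] aut_inv_apply(2)[OF A words_lists[OF v]] b by (simp add: directed_def)
  moreover have "st (aut_inv b) y \<in> finitary m" if y: "y \<in> words S m" "y \<noteq> b v" for y
  proof -
    have "aut_inv b y \<noteq> v"
      using aut_inv_apply(1)[OF A words_lists[OF y(1)]] y(2) by auto
    then have "st b (aut_inv b y) \<in> finitary m"
      using b A y(1) by (simp add: directed_def)
    then show ?thesis
      using st_inv[OF A words_lists[OF y(1)]] finitary_inv by simp
  qed
  ultimately show ?thesis
    using A by (simp add: directed_def)
qed

lemma directed_mult_iff:
  assumes b: "b \<in> directed m v" and v: "v \<in> words S m" and g: "g \<in> Aut"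
  shows "g \<cdot> b \<in> directed m v \<longleftrightarrow> g \<in> directed m (b v)"
proof
  note A = directed_Aut[OF b]
  assume gb: "g \<cdot> b \<in> directed m v"
  have "(g \<cdot> b) \<cdot> aut_inv b \<in> directed m (b v)"
    using directed_mult[OF directed_inv[OF b v]] aut_inv_apply(2)[OF A words_lists[OF v]] gb A v
    by simp
  then show "g \<in> directed m (b v)"
    using W.m_assoc[of g b "aut_inv b"] g A by simp
qed (rule directed_mult[OF b v])

lemma finitary_mult_iff:
  assumes a: "a \<in> finitary m" and g: "g \<in> Aut"
  shows "g \<cdot> a \<in> finitary m \<longleftrightarrow> g \<in> finitary m"
proof
  note A = finitary_Aut[OF a]
  assume "g \<cdot> a \<in> finitary m"
  then have "(g \<cdot> a) \<cdot> aut_inv a \<in> finitary m"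
    by (rule finitary_mult[OF _ finitary_inv[OF a]])
  then show "g \<in> finitary m"
    using W.m_assoc[of g a "aut_inv a"] g A by simp
qed (rule finitary_mult[OF _ a])

text \<open>A directed automorphism is determined by its values on words of length at most
  \<open>m\<close> and its states off \<open>v\<close>: after a prefix \<open>v\<close> the same
  automorphism acts on a word shorter by \<open>m\<close>, so the recursion ends as
  \<open>1 \<le> m\<close>.\<close>

lemma finite_directed:
  assumes m: "1 \<le> m" and v: "v \<in> words S m"
  shows "finite (directed m v)"
proof -
  let ?L = "{w \<in> lists S. length w \<le> m}"
  let ?Y = "words S m - {v}"
  have finL: "finite ?L"
    using finite_lists_length_le[OF finite_S, of m] by (simp add: lists_eq_set)
  let ?\<Phi> = "\<lambda>f. (restrict f ?L, restrict (st f) ?Y)"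
  have "?\<Phi> ` directed m v \<subseteq> PiE ?L (\<lambda>_. ?L) \<times> PiE ?Y (\<lambda>_. finitary m)"
  proof (clarify, intro conjI)
    fix f assume f: "f \<in> directed m v"
    show "restrict f ?L \<in> PiE ?L (\<lambda>_. ?L)"
      using aut_lists[OF directed_Aut[OF f]] tree_auts_length[OF directed_Aut[OF f]] by simp
    show "restrict (st f) ?Y \<in> PiE ?Y (\<lambda>_. finitary m)"
      using f by (simp add: directed_def)
  qed
  moreover have "finite (PiE ?L (\<lambda>_. ?L) \<times> PiE ?Y (\<lambda>_. finitary m))"
    using finL finite_finitary finite_words by (intro finite_cartesian_product finite_PiE) auto
  ultimately have "finite (?\<Phi> ` directed m v)"
    by (rule finite_subset)
  moreover have "inj_on ?\<Phi> (directed m v)"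
  proof (rule inj_onI)
    fix f g assume f: "f \<in> directed m v" and g: "g \<in> directed m v" and eq: "?\<Phi> f = ?\<Phi> g"
    have short: "f u = g u" if "u \<in> lists S" "length u \<le> m" for u
      using eq that by (metis (no_types, lifting) mem_Collect_eq prod.inject restrict_apply')
    have sts: "st f u = st g u" if "u \<in> words S m" "u \<noteq> v" for u
      using eq that by (metis (no_types, lifting) DiffI prod.inject restrict_apply' singletonD)
    have eq: "f u = g u" if "u \<in> lists S" for u
      using that
    proof (induction "length u" arbitrary: u rule: less_induct)
      case less
      show ?case
      proof (cases "length u \<le> m")
        case False
        then have "u \<in> words S (m + (length u - m))"
          using less.prems by (simp add: words_def)
        then obtain p q where pq: "p \<in> words S m" "q \<in> words S (length u - m)" "u = p @ q"
          by (rule words_split)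
        note pql = words_lists[OF pq(1)] words_lists[OF pq(2)]
        have "length q < length u"
          using pq m by (simp add: words_def)
        then have "f q = g q"
          using less.hyps pql(2) by blast
        then have "st f p q = st g p q"
          using sts[OF pq(1)] f g by (cases "p = v") (simp_all add: directed_def)
        then show ?thesis
          using short[of p] pq state_append[OF directed_Aut[OF f] pql]
            state_append[OF directed_Aut[OF g] pql] by (simp add: words_def)
      qed (use short less.prems in blast)
    qed
    show "f = g"
      by (rule aut_ext[OF directed_Aut[OF f] directed_Aut[OF g] eq])
  qed
  ultimately show ?thesis
    by (rule finite_imageD)
qed

section \<open>Cells and almost invariant means\<close>

definition cell :: "nat \<Rightarrow> nat \<Rightarrow> 'a list list set \<Rightarrow> ('a list \<Rightarrow> 'a list) set" where
  "cell m K E = {g \<in> Aut. \<forall>us\<in>blocks m K.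
     st g (concat us) \<in> (if us \<in> E then directed m (last us) else finitary m)}"

lemma cell_Aut: "cell m K E \<subseteq> Aut"
  by (auto simp: cell_def)

lemma last_blocks: "us \<in> blocks m K \<Longrightarrow> 1 \<le> K \<Longrightarrow> last us \<in> words S m"
  by (cases "us = []") (auto simp: blocks_def)

text \<open>Cells are nonempty, so they carry uniform distributions.\<close>

lemma one_cell: "1 \<le> K \<Longrightarrow> aut_one \<in> cell m K E"
  using one_finitary one_directed last_blocks words_lists[OF concat_blocks] by (simp add: cell_def)

lemma finite_cell:
  assumes m: "1 \<le> m" and K: "1 \<le> K"
  shows "finite (cell m K E)"
proof (rule finite_subset)
  let ?R = "finitary m \<union> (\<Union>v\<in>words S m. directed m v)"
  show "cell m K E \<subseteq> {f \<in> Aut. \<forall>w\<in>words S (m * K). st f w \<in> ?R}"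
  proof
    fix g assume g: "g \<in> cell m K E"
    have "st g w \<in> ?R" if w: "w \<in> words S (m * K)" for w
    proof -
      obtain us where us: "us \<in> blocks m K" "w = concat us"
        using words_concat_blocks[OF w] by blast
      then have "st g w \<in> (if us \<in> E then directed m (last us) else finitary m)"
        using g by (simp add: cell_def)
      then show ?thesis
        using last_blocks[OF us(1) K] by (auto split: if_splits)
    qed
    then show "g \<in> {f \<in> Aut. \<forall>w\<in>words S (m * K). st f w \<in> ?R}"
      using g by (simp add: cell_def)
  qed
  show "finite {f \<in> Aut. \<forall>w\<in>words S (m * K). st f w \<in> ?R}"
    using finite_finitary finite_directed[OF m] finite_words by (intro finite_auts_with_states_in) auto
qed

text \<open>The state of the product at \<open>us\<close> is that of \<open>g\<close> at
  \<open>act s us\<close> times the state \<open>t\<close> of \<open>s\<close> at \<open>us\<close>.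
  If \<open>t\<close> is directed, \<open>E1\<close> puts \<open>act s us\<close> into
  \<open>E\<close>, and \<open>t\<close> is an arrow between the two last blocks. If
  \<open>t\<close> is trivial, the last blocks agree. If \<open>t\<close> is finitary in the
  remaining case, \<open>E2\<close> keeps \<open>act s us\<close> out of \<open>E\<close>. Each time
  the conditions at \<open>us\<close> and at \<open>act s us\<close> are equivalent.\<close>

lemma cell_mult_iff:
  assumes s: "tame m s" and K: "5 \<le> K" and g: "g \<in> Aut"
    and E1: "{us \<in> blocks m K. ell us \<le> 3} \<subseteq> E" and E2: "\<And>us. us \<in> E \<Longrightarrow> ell us + 2 < K"
  shows "g \<cdot> s \<in> cell m K {us \<in> blocks m K. act s us \<in> E} \<longleftrightarrow> g \<in> cell m K E"
proof -
  have A: "s \<in> Aut"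
    using s by (simp add: tame_def)
  let ?R = "\<lambda>E us. if us \<in> E then directed m (last us) else finitary m"
  let ?E' = "{us \<in> blocks m K. act s us \<in> E}"
  have *: "st (g \<cdot> s) (concat us) \<in> ?R ?E' us \<longleftrightarrow> st g (concat (act s us)) \<in> ?R E (act s us)"
    if us: "us \<in> blocks m K" for us
  proof -
    let ?t = "st s (concat us)" and ?h = "st g (concat (act s us))"
    have l: "concat us \<in> lists S"
      using words_lists[OF concat_blocks[OF us]] .
    have h: "?h \<in> Aut"
      using g words_lists[OF concat_blocks[OF act_blocks[OF A us]]] by simp
    have st: "st (g \<cdot> s) (concat us) = ?h \<cdot> ?t"
      using st_mult[OF g A l] concat_act[OF A us] by simp
    from act_tame_trichotomy[OF s us K] show ?thesis
    proof (elim disjE conjE bexE)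
      fix v assume v: "v \<in> words S m" "?t \<in> directed m v" "last us = v"
        "last (act s us) = ?t v" "ell (act s us) \<le> 1"
      then have "act s us \<in> E"
        using E1 act_blocks[OF A us] by auto
      then show ?thesis
        using directed_mult_iff[OF v(2,1) h] v us st by simp
    next
      assume "?t = aut_one" "last (act s us) = last us"
      then show ?thesis
        using st us h by simp
    next
      assume *: "?t \<in> finitary m" "K \<le> ell (act s us) + 2"
      then have "act s us \<notin> E"
        using E2 by force
      then show ?thesis
        using finitary_mult_iff[OF *(1) h] st by simp
    qed
  qed
  have "g \<cdot> s \<in> cell m K ?E' \<longleftrightarrow> (\<forall>us\<in>blocks m K. st g (concat (act s us)) \<in> ?R E (act s us))"
    using * g A unfolding cell_def by simp
  also have "\<dots> \<longleftrightarrow> (\<forall>us\<in>act s ` blocks m K. st g (concat us) \<in> ?R E us)"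
    by blast
  also have "act s ` blocks m K = blocks m K"
    using act_bij[OF A] by (simp add: bij_betw_def)
  finally show ?thesis
    using g unfolding cell_def by simp
qed

end

text \<open>The angle falls linearly from \<open>pi / 2\<close> at \<open>l = 3\<close> to 0 at
  \<open>l = n + 3\<close> and is clamped outside. The first threshold comes from
  \<open>ell_act_tame\<close>; the second is \<open>K - 2\<close> for \<open>K = n + 5\<close>,
  matching \<open>E2\<close> in \<open>cell_mult_iff\<close>.\<close>

definition angle :: "nat \<Rightarrow> nat \<Rightarrow> real" where
  "angle n l = pi / 2 * max 0 (min 1 ((real n + 3 - real l) / real n))"

lemma angle_top: "1 \<le> n \<Longrightarrow> l \<le> 3 \<Longrightarrow> angle n l = pi / 2"
  by (simp add: angle_def min_absorb1)

lemma angle_0: "n + 3 \<le> l \<Longrightarrow> angle n l = 0"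
proof -
  assume "n + 3 \<le> l"
  then have "(real n + 3 - real l) / real n \<le> 0"
    by (intro divide_nonpos_nonneg) auto
  then show ?thesis
    by (simp add: angle_def max_absorb1 min_absorb2)
qed

lemma angle_bounds: "0 \<le> angle n l" "angle n l \<le> pi / 2"
proof -
  have "max 0 (min 1 ((real n + 3 - real l) / real n)) \<le> 1"
    by simp
  then have "angle n l \<le> pi / 2 * 1"
    unfolding angle_def by (intro mult_left_mono) simp_all
  then show "angle n l \<le> pi / 2"
    by simp
qed (simp add: angle_def)

lemma angle_diff_le_half_pi: "\<bar>angle n l - angle n l'\<bar> \<le> pi / 2"
  using angle_bounds[of n l] angle_bounds[of n l'] by linarith

lemma angle_diff:
  assumes n: "1 \<le> n" and l: "l \<le> l' + 2" "l' \<le> l + 2"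
  shows "\<bar>angle n l - angle n l'\<bar> \<le> pi / real n"
proof -
  define x y where "x = (real n + 3 - real l) / real n" and "y = (real n + 3 - real l') / real n"
  have "\<bar>max 0 (min 1 x) - max 0 (min 1 y)\<bar> \<le> \<bar>x - y\<bar>"
    by linarith
  also have "x - y = (real l' - real l) / real n"
    by (simp add: x_def y_def diff_divide_distrib[symmetric])
  also have "\<bar>\<dots>\<bar> \<le> 2 / real n"
    using l by (auto simp: abs_divide intro!: divide_right_mono)
  finally have le: "\<bar>max 0 (min 1 x) - max 0 (min 1 y)\<bar> \<le> 2 / real n" .
  have "\<bar>angle n l - angle n l'\<bar> = pi / 2 * \<bar>max 0 (min 1 x) - max 0 (min 1 y)\<bar>"
    unfolding angle_def x_def[symmetric] y_def[symmetric] right_diff_distrib[symmetric] abs_mult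
    by simp
  also have "\<dots> \<le> pi / 2 * (2 / real n)"
    using le by (intro mult_left_mono) simp_all
  also have "\<dots> = pi / real n"
    by simp
  finally show ?thesis .
qed

text \<open>Taking preimages under \<open>f\<close> thus carries the random set with angles
  \<open>t\<close> to the one with angles \<open>t \<circ> f\<close>.\<close>

lemma bern_reindex:
  assumes f: "bij_betw f U U" and E: "E \<subseteq> U"
  shows "bern U t E = bern U (t \<circ> f) {u \<in> U. f u \<in> E}"
proof -
  have "bern U t E = (\<Prod>u\<in>U. if f u \<in> E then sin (t (f u)) else cos (t (f u)))"
    unfolding bern_def by (rule prod.reindex_bij_betw[OF f, symmetric])
  also have "\<dots> = bern U (t \<circ> f) {u \<in> U. f u \<in> E}"
    unfolding bern_def by (intro prod.cong) auto
  finally show ?thesis .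
qed

lemma bij_betw_vimage_Pow:
  assumes f: "bij_betw f U U"
  shows "bij_betw (\<lambda>E. {u \<in> U. f u \<in> E}) (Pow U) (Pow U)"
proof (rule bij_betw_byWitness[where f' = "(`) f"])
  show "\<forall>E\<in>Pow U. f ` {u \<in> U. f u \<in> E} = E"
    using f by (fastforce simp: bij_betw_def)
  show "\<forall>E\<in>Pow U. {u \<in> U. f u \<in> f ` E} = E"
    using inj_on_image_mem_iff[OF bij_betw_imp_inj_on[OF f]] by blast
  show "(`) f ` Pow U \<subseteq> Pow U"
    using f by (auto simp: bij_betw_def)
qed auto

section \<open>Estimates and the almost invariant mean\<close>

context finite_alphabet
begin

text \<open>Words whose \<open>ell\<close> is unchanged, or at most 3 before and after, contribute
  nothing because their angle stays the same. The others are counted by \<open>card_changed\<close>,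
  and their \<open>ell\<close> moves by at most 2.\<close>

lemma energy_bound:
  assumes s: "tame m s" and n: "1 \<le> n"
  shows "(\<Sum>us\<in>blocks m K. (angle n (ell us) - angle n (ell (act s us)))\<^sup>2)
    \<le> real (K * card (words S m) ^ 5) * (pi / real n)\<^sup>2" (is "sum ?f _ \<le> _")
proof -
  let ?D = "{us \<in> blocks m K. ell (act s us) \<noteq> ell us \<and> \<not> (ell us \<le> 3 \<and> ell (act s us) \<le> 3)}"
  have "sum ?f (blocks m K) = sum ?f ?D"
  proof (rule sum.mono_neutral_right[OF finite_blocks])
    show "\<forall>us\<in>blocks m K - ?D. ?f us = 0"
    proof
      fix us assume "us \<in> blocks m K - ?D"
      then have "ell (act s us) = ell us \<or> ell us \<le> 3 \<and> ell (act s us) \<le> 3"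
        by blast
      then show "?f us = 0"
        by (elim disjE) (simp_all add: angle_top[OF n])
    qed
  qed blast
  also have "\<dots> \<le> of_nat (card ?D) * (pi / real n)\<^sup>2"
  proof (rule sum_bounded_above)
    fix us assume us: "us \<in> ?D"
    then have "us \<in> blocks m K"
      by simp
    from ell_act_tame[OF s this] us
    have "ell us \<le> ell (act s us) + 2" "ell (act s us) \<le> ell us + 2"
      by auto
    then have "\<bar>angle n (ell us) - angle n (ell (act s us))\<bar> \<le> pi / real n"
      by (rule angle_diff[OF n])
    then show "?f us \<le> (pi / real n)\<^sup>2"
      by (simp add: abs_le_square_iff[symmetric])
  qed
  also have "\<dots> \<le> real (K * card (words S m) ^ 5) * (pi / real n)\<^sup>2"
    using card_changed[OF s, of K] by (intro mult_right_mono of_nat_mono) simp_all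
  finally show ?thesis .
qed

text \<open>A word with angle \<open>pi / 2\<close> lies in the random set almost surely, and one
  with angle 0 almost surely does not. So every set of positive probability meets the assumptions of
  \<open>cell_mult_iff\<close>.\<close>

lemma bern_nonzero_good:
  assumes n: "1 \<le> n" and E: "E \<subseteq> blocks m (n + 5)"
    and nz: "bern (blocks m (n + 5)) (\<lambda>us. angle n (ell us)) E \<noteq> 0"
  shows "{us \<in> blocks m (n + 5). ell us \<le> 3} \<subseteq> E" "\<And>us. us \<in> E \<Longrightarrow> ell us + 2 < n + 5"
proof -
  let ?t = "\<lambda>us. angle n (ell us)"
  have nz': "(if us \<in> E then sin (?t us) else cos (?t us)) \<noteq> 0" if "us \<in> blocks m (n + 5)" for us
    using nz that finite_blocks unfolding bern_def by (auto simp: prod_zero_iff)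
  show "{us \<in> blocks m (n + 5). ell us \<le> 3} \<subseteq> E"
  proof
    fix us assume us: "us \<in> {us \<in> blocks m (n + 5). ell us \<le> 3}"
    then have "cos (?t us) = 0" "us \<in> blocks m (n + 5)"
      using angle_top[OF n, of "ell us"] by (simp_all only: mem_Collect_eq cos_pi_half)
    then show "us \<in> E"
      using nz'[of us] by (simp split: if_splits)
  qed
  fix us assume us: "us \<in> E"
  show "ell us + 2 < n + 5"
  proof (rule ccontr)
    assume "\<not> ell us + 2 < n + 5"
    then have "?t us = 0"
      by (intro angle_0) simp
    moreover have "us \<in> blocks m (n + 5)"
      using us E by blast
    ultimately show False
      using nz'[of us] us by simp
  qed
qed

lemma cell_vimage:
  assumes s: "tame m s" and K: "5 \<le> K"
    and E1: "{us \<in> blocks m K. ell us \<le> 3} \<subseteq> E" and E2: "\<And>us. us \<in> E \<Longrightarrow> ell us + 2 < K"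
    and A: "A \<subseteq> Aut"
  shows "card ((\<lambda>a. a \<cdot> s) ` A \<inter> cell m K {us \<in> blocks m K. act s us \<in> E}) = card (A \<inter> cell m K E)"
proof -
  have sA: "s \<in> Aut"
    using s by (simp add: tame_def)
  have "(\<lambda>a. a \<cdot> s) ` A \<inter> cell m K {us \<in> blocks m K. act s us \<in> E} = (\<lambda>a. a \<cdot> s) ` (A \<inter> cell m K E)"
    using cell_mult_iff[OF s K _ E1 E2] A by blast
  moreover have "inj_on (\<lambda>a. a \<cdot> s) (A \<inter> cell m K E)"
    using W.inj_on_cmult[of s] A sA by (intro inj_onI) (simp add: subset_iff)
  ultimately show ?thesis
    by (simp add: card_image)
qed

text \<open>The mean is the law of a uniformly random element of the cell of a random set
  \<open>E\<close>. Translation by \<open>s\<close> carries uniform laws on cells to uniform laws on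
  cells, so the error is at most the variation between the laws of two random sets.\<close>

lemma almost_invariant_mean:
  assumes m: "1 \<le> m" and F: "\<And>s. s \<in> F \<Longrightarrow> tame m s" and e: "0 < (e::real)"
  shows "\<exists>\<mu>. mean_on Aut \<mu> \<and> (\<forall>s\<in>F. \<forall>A\<subseteq>Aut. \<bar>\<mu> ((\<lambda>a. a \<cdot> s) ` A) - \<mu> A\<bar> \<le> e)"
proof -
  define C where "C = real (card (words S m) ^ 5) * pi\<^sup>2"
  \<comment> \<open>The final bound is \<open>8 C / n\<close>, obtained from
    \<open>K \<le> 2 n\<close>; that inequality is why 5 is added to \<open>n0\<close>.\<close>
  obtain n0 :: nat where n0: "8 * C / e\<^sup>2 \<le> real n0"
    using real_arch_simple by blast
  define n where "n = n0 + 5"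
  have n: "1 \<le> n" "5 \<le> n" "8 * C / e\<^sup>2 \<le> real n"
    using n0 by (simp_all add: n_def)
  define K where "K = n + 5"
  define U where "U = blocks m K"
  define t where "t us = angle n (ell us)" for us :: "'a list list"
  define p where "p E = (bern U t E)\<^sup>2" for E
  define r where "r A E = real (card (A \<inter> cell m K E)) / real (card (cell m K E))" for A E
  define \<mu> where "\<mu> A = (\<Sum>E\<in>Pow U. p E * r A E)" for A
  have K: "5 \<le> K" "1 \<le> K"
    by (simp_all add: K_def)
  have finU: "finite U"
    unfolding U_def by (rule finite_blocks)
  have fin: "finite (cell m K E)" for E
    by (rule finite_cell[OF m K(2)])
  have pos: "0 < card (cell m K E)" for E
    using one_cell[OF K(2)] fin card_gt_0_iff by blast
  have r: "0 \<le> r A E" "r A E \<le> 1" for A E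
    using card_mono[OF fin, of "A \<inter> cell m K E" E] by (auto simp: r_def divide_le_eq_1)
  have "mean_on Aut \<mu>"
    unfolding mean_on_def
  proof (intro conjI allI impI)
    show "0 \<le> \<mu> A" for A
      unfolding \<mu>_def p_def using r by (intro sum_nonneg mult_nonneg_nonneg) simp_all
    have "r Aut E = 1" for E
      using pos[of E] cell_Aut[of m K E] by (simp add: r_def Int_absorb1)
    then show "\<mu> Aut = 1"
      using sum_bern_square[OF finU] by (simp add: \<mu>_def p_def)
    fix A B :: "('a list \<Rightarrow> 'a list) set" assume "A \<inter> B = {}"
    then have "card ((A \<union> B) \<inter> cell m K E) = card (A \<inter> cell m K E) + card (B \<inter> cell m K E)" for E
      unfolding Int_Un_distrib2 using fin by (intro card_Un_disjoint) auto
    then have "r (A \<union> B) E = r A E + r B E" for E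
      by (simp add: r_def add_divide_distrib)
    then show "\<mu> (A \<union> B) = \<mu> A + \<mu> B"
      by (simp add: \<mu>_def distrib_left sum.distrib)
  qed
  moreover have "\<bar>\<mu> ((\<lambda>a. a \<cdot> s) ` A) - \<mu> A\<bar> \<le> e" if s: "s \<in> F" and A: "A \<subseteq> Aut" for s A
  proof -
    have tame: "tame m s"
      using F s by blast
    then have sA: "s \<in> Aut"
      by (simp add: tame_def)
    let ?As = "(\<lambda>a. a \<cdot> s) ` A"
    define \<phi> where "\<phi> E = {us \<in> U. act s us \<in> E}" for E
    have bij: "bij_betw (act s) U U"
      unfolding U_def by (rule act_bij[OF sA])
    have \<phi>: "bij_betw \<phi> (Pow U) (Pow U)"
      unfolding \<phi>_def by (rule bij_betw_vimage_Pow[OF bij])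
    have pr: "p E * r A E = p E * r ?As (\<phi> E)" if E: "E \<in> Pow U" for E
    proof (cases "bern U t E = 0")
      case False
      have good: "{us \<in> blocks m K. ell us \<le> 3} \<subseteq> E" "\<And>us. us \<in> E \<Longrightarrow> ell us + 2 < K"
        using bern_nonzero_good[OF n(1), of E m] E False unfolding U_def t_def K_def by simp_all
      \<comment> \<open>Since right translation by \<open>s\<close> maps \<open>Aut\<close> onto
        itself, \<open>cell_vimage\<close> with \<open>A = Aut\<close> compares whole cells.\<close>
      have "card (cell m K (\<phi> E)) = card (cell m K E)"
      proof -
        have "(\<lambda>a. a \<cdot> s) ` Aut = Aut"
        proof (intro equalityI subsetI)
          fix h assume "h \<in> Aut"
          then have "h = (h \<cdot> aut_inv s) \<cdot> s" "h \<cdot> aut_inv s \<in> Aut"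
            using sA by (simp_all add: W.m_assoc)
          then show "h \<in> (\<lambda>a. a \<cdot> s) ` Aut"
            by blast
        qed (use sA in auto)
        then show ?thesis
          using cell_vimage[OF tame K(1) good, of Aut] cell_Aut
          by (simp add: \<phi>_def U_def Int_absorb1)
      qed
      then show ?thesis
        using cell_vimage[OF tame K(1) good A] by (simp add: r_def \<phi>_def U_def)
    qed (simp add: p_def)
    have "\<mu> A = (\<Sum>E\<in>Pow U. p E * r ?As (\<phi> E))"
      unfolding \<mu>_def by (intro sum.cong refl pr)
    then have "\<mu> ?As - \<mu> A = (\<Sum>E\<in>Pow U. p (\<phi> E) * r ?As (\<phi> E)) - (\<Sum>E\<in>Pow U. p E * r ?As (\<phi> E))"
      using sum.reindex_bij_betw[OF \<phi>, of "\<lambda>E. p E * r ?As E"] by (simp add: \<mu>_def)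
    also have "\<dots> = (\<Sum>E\<in>Pow U. (p (\<phi> E) - p E) * r ?As (\<phi> E))"
      by (simp add: sum_subtractf left_diff_distrib)
    also have "\<bar>\<dots>\<bar> \<le> (\<Sum>E\<in>Pow U. \<bar>p (\<phi> E) - p E\<bar>)"
    proof (rule order_trans[OF sum_abs sum_mono])
      fix E
      show "\<bar>(p (\<phi> E) - p E) * r ?As (\<phi> E)\<bar> \<le> \<bar>p (\<phi> E) - p E\<bar>"
        using r[of ?As "\<phi> E"] by (simp add: abs_mult mult_left_le)
    qed
    \<comment> \<open>The weight \<open>p E\<close> is rewritten as the probability of
      \<open>\<phi> E\<close> for the angles \<open>t \<circ> act s\<close>, so that both weights
      are taken at the same set.\<close>
    also have "\<dots> = (\<Sum>E\<in>Pow U. \<bar>(bern U t (\<phi> E))\<^sup>2 - (bern U (t \<circ> act s) (\<phi> E))\<^sup>2\<bar>)"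
      using bern_reindex[OF bij, of _ t] by (simp add: p_def \<phi>_def)
    also have "\<dots> = (\<Sum>E\<in>Pow U. \<bar>(bern U t E)\<^sup>2 - (bern U (t \<circ> act s) E)\<^sup>2\<bar>)"
      by (rule sum.reindex_bij_betw[OF \<phi>])
    finally have 1: "\<bar>\<mu> ?As - \<mu> A\<bar> \<le> (\<Sum>E\<in>Pow U. \<bar>(bern U t E)\<^sup>2 - (bern U (t \<circ> act s) E)\<^sup>2\<bar>)" .
    then have "\<bar>\<mu> ?As - \<mu> A\<bar>\<^sup>2 \<le> (\<Sum>E\<in>Pow U. \<bar>(bern U t E)\<^sup>2 - (bern U (t \<circ> act s) E)\<^sup>2\<bar>)\<^sup>2"
      by (intro power_mono) simp_all
    also have "\<dots> \<le> 4 * (\<Sum>us\<in>U. (t us - (t \<circ> act s) us)\<^sup>2)"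
      using angle_diff_le_half_pi by (intro bern_variation[OF finU]) (simp add: t_def)
    also have "(\<Sum>us\<in>U. (t us - (t \<circ> act s) us)\<^sup>2) \<le> real (K * card (words S m) ^ 5) * (pi / real n)\<^sup>2"
      using energy_bound[OF tame n(1), of K] by (simp add: t_def U_def)
    also have "4 * (real (K * card (words S m) ^ 5) * (pi / real n)\<^sup>2) = 4 * C * (real K / (real n)\<^sup>2)"
      by (simp add: C_def power_divide)
    also have "\<dots> \<le> 4 * C * (2 / real n)"
    proof (intro mult_left_mono)
      have "real K \<le> 2 * real n"
        using n(2) by (simp add: K_def)
      then show "real K / (real n)\<^sup>2 \<le> 2 / real n"
        using n(1) by (simp add: divide_simps power2_eq_square)
    qed (simp add: C_def)
    also have "\<dots> \<le> e\<^sup>2"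
      using n(1,3) e by (simp add: field_simps)
    finally have "\<bar>\<mu> ?As - \<mu> A\<bar>\<^sup>2 \<le> e\<^sup>2"
      by simp
    then show ?thesis
      using e by (simp add: abs_le_square_iff[symmetric])
  qed
  ultimately show ?thesis
    by blast
qed

end

theorem theorem1p2:
  fixes S :: "'a set"
  assumes "finite S"
  shows "amenable (BA_group S)"
proof -
  interpret finite_alphabet S
    by unfold_locales (rule assms)
  let ?C = "{f \<in> Aut. bounded_aut S f \<and> automatic S f}"
  have approx: "\<exists>\<mu>. mean_on Aut \<mu> \<and> (\<forall>s\<in>F. \<forall>A\<subseteq>Aut. \<bar>\<mu> ((\<lambda>a. a \<cdot> s) ` A) - \<mu> A\<bar> \<le> e)"
    if F: "finite F" "F \<subseteq> ?C" and e: "0 < (e::real)" for F e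
  proof -
    \<comment> \<open>Finiteness of \<open>F\<close> allows one block length \<open>m\<close> for
      all its elements.\<close>
    obtain m where "1 \<le> m" "\<And>s. s \<in> F \<Longrightarrow> tame m s"
      by (rule bounded_automatic_tame[of F]) (use F in auto)
    then show ?thesis
      using almost_invariant_mean[of m F e] e by blast
  qed
  have translate: "(\<lambda>a. a \<cdot> s) ` A \<subseteq> Aut" if "s \<in> ?C" "A \<subseteq> Aut" for s A
    using that by (auto simp: subset_iff)
  have "\<exists>\<mu>. mean_on Aut \<mu> \<and> (\<forall>s\<in>?C. \<forall>A\<subseteq>Aut. \<mu> ((\<lambda>a. a \<cdot> s) ` A) = \<mu> A)"
    by (rule invariant_mean_from_almost_invariant[OF translate approx])
  then obtain \<mu> where \<mu>: "mean_on Aut \<mu>"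
    "\<And>s A. s \<in> ?C \<Longrightarrow> A \<subseteq> Aut \<Longrightarrow> \<mu> ((\<lambda>a. a \<cdot> s) ` A) = \<mu> A"
    by blast
  have "amenable (W\<lparr>carrier := ?C\<rparr>)"
    by (rule amenable_subgroup_from_right_invariant_mean
          [OF W.is_group subgroup_bounded_automatic, where m = \<mu>]) (simp_all only: carrier_W \<mu>)
  then show ?thesis
    by (simp add: BA_group_def)
qed

end
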